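(* Let $n\geq 4$ and $2\leq k\leq n-2$. If $G$ is a connected graph on $n$ vertices with exactly $k$ pendant vertices, then $F(G)\geq F\bigl(T(\lfloor k/2\rfloor,\lceil k/2\rceil,n-k)\bigr)$, with equality if and only if $G$ is isomorphic to $T(\lfloor k/2\rfloor,\lceil k/2\rceil,n-k)$.
   Context: All graphs are finite, simple and undirected. A pendant vertex is a vertex of degree one. For positive integers $k,l,d$, $T(k,l,d)$ is the tree on $k+l+d$ vertices obtained from the path $v_1v_2\cdots v_d$ by attaching $k$ new pendant vertices to $v_1$ and $l$ new pendant vertices to $v_d$. A connected subgraph of a graph $G=(V,E)$ is a graph $(V',E')$ with $\emptyset\neq V'\subseteq V$, $E'\subseteq E$, every edge of $E'$ having both endpoints in $V'$, and $(V',E')$ connected; distinct pairs $(V',E')$ are counted separately. The core index $F(G)$ is the number of connected subgraphs of $G$. *)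

theory Defs
  imports Main
begin

text \<open>A graph is a pair of a vertex set and a set of edges, each edge being a two-element set of
  vertices.\<close>

type_synonym 'a ugraph = "'a set \<times> 'a set set"

abbreviation verts :: "'a ugraph \<Rightarrow> 'a set" where
  "verts G \<equiv> fst G"

abbreviation edges :: "'a ugraph \<Rightarrow> 'a set set" where
  "edges G \<equiv> snd G"

definition simple_graph :: "'a ugraph \<Rightarrow> bool" where
  "simple_graph G \<longleftrightarrow> finite (verts G) \<and> (\<forall>e\<in>edges G. e \<subseteq> verts G \<and> card e = 2)"

definition adj_rel :: "'a ugraph \<Rightarrow> ('a \<times> 'a) set" where
  "adj_rel G = {(u, v). {u, v} \<in> edges G}"

definition connected_graph :: "'a ugraph \<Rightarrow> bool" where
  "connected_graph G \<longleftrightarrow>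
     verts G \<noteq> {} \<and> (\<forall>u\<in>verts G. \<forall>v\<in>verts G. (u, v) \<in> (adj_rel G)\<^sup>*)"

definition degree :: "'a ugraph \<Rightarrow> 'a \<Rightarrow> nat" where
  "degree G v = card {e \<in> edges G. v \<in> e}"

definition pendant_verts :: "'a ugraph \<Rightarrow> 'a set" where
  "pendant_verts G = {v \<in> verts G. degree G v = 1}"

definition is_subgraph :: "'a ugraph \<Rightarrow> 'a ugraph \<Rightarrow> bool" where
  "is_subgraph H G \<longleftrightarrow>
     verts H \<subseteq> verts G \<and> edges H \<subseteq> edges G \<and> (\<forall>e\<in>edges H. e \<subseteq> verts H)"

definition connected_subgraphs :: "'a ugraph \<Rightarrow> 'a ugraph set" where
  "connected_subgraphs G = {H. is_subgraph H G \<and> connected_graph H}"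

definition core_index :: "'a ugraph \<Rightarrow> nat" where
  "core_index G = card (connected_subgraphs G)"

definition isomorphic :: "'a ugraph \<Rightarrow> 'b ugraph \<Rightarrow> bool" where
  "isomorphic G H \<longleftrightarrow>
     (\<exists>f. bij_betw f (verts G) (verts H) \<and>
          (\<forall>u\<in>verts G. \<forall>v\<in>verts G. {u, v} \<in> edges G \<longleftrightarrow> {f u, f v} \<in> edges H))"

text \<open>The tree $T(k,l,d)$: the path is on the vertices $1,\dots,d$, the $k$ pendant vertices attached
  to the vertex $1$ are $d+1,\dots,d+k$, and the $l$ pendant vertices attached to the vertex $d$ are
  $d+k+1,\dots,d+k+l$.\<close>

definition T_tree :: "nat \<Rightarrow> nat \<Rightarrow> nat \<Rightarrow> nat ugraph" where
  "T_tree k l d =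
     ({1..d + k + l},
      {{i, i + 1} | i. i \<in> {1..<d}}
      \<union> {{1, j} | j. j \<in> {d + 1..d + k}}
      \<union> {{d, j} | j. j \<in> {d + k + 1..d + k + l}})"

lemma finite_connected_subgraphs:
  assumes "simple_graph G"
  shows "finite (connected_subgraphs G)"
proof (rule finite_subset)
  show "connected_subgraphs G \<subseteq> Pow (verts G) \<times> Pow (edges G)"
    by (auto simp: connected_subgraphs_def is_subgraph_def)
  have "edges G \<subseteq> Pow (verts G)"
    using assms by (auto simp: simple_graph_def)
  then show "finite (Pow (verts G) \<times> Pow (edges G))"
    using assms by (auto simp: simple_graph_def intro: finite_subset)
qed

lemma card_verts_T_tree: "card (verts (T_tree k l d)) = k + l + d"
  by (simp add: T_tree_def)

lemma simple_graph_T_tree: "0 < d \<Longrightarrow> simple_graph (T_tree k l d)"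
  by (auto simp: simple_graph_def T_tree_def card_insert_if)

end

theory Submission
  imports Defs
begin

text \<open>
  Let $P$ be the set of the $k$ pendant vertices, $G' = G - P$, $d = n - k$ the order of $G'$, and
  $w(X)$ the number of pendant vertices attached to a set $X$ of vertices of $G'$. A connected
  subgraph of $G$ is a single pendant vertex, or a connected subgraph $H$ of $G'$ with an arbitrary
  subset of the pendant vertices attached to it, so $F(G) = k + \sum_H 2^{w(V(H))}$.

  Call $X$ a cut set if both $X$ and its complement are nonempty and connected in $G'$. There are at
  least $2(d-1)$ of them, and the contributions of $X$ and of its complement add up to
  $2^x + 2^{k-x} \ge c$ with $c = 2^{\lfloor k/2\rfloor} + 2^{\lceil k/2\rceil}$. Moreover $G'$ has
  at least $d(d+1)/2$ connected subgraphs, with equality only for a path. The term $H = G'$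
  contributes $2^k$ and every remaining $H$ at least $1$, hence
  $F(G) \ge k + 2^k + (d-1)c + (d-1)(d-2)/2$, which is the value at the tree $T$. Equality forces
  $G'$ to be a path, its interior vertices to carry no pendant vertex, and the numbers at its two
  ends to be balanced.
\<close>

section \<open>Connectivity through cuts\<close>

definition induced :: "'a ugraph \<Rightarrow> 'a set \<Rightarrow> 'a ugraph" where
  "induced G X = (X, {e \<in> edges G. e \<subseteq> X})"

lemma induced_simps [simp]:
  "verts (induced G X) = X" "edges (induced G X) = {e \<in> edges G. e \<subseteq> X}"
  by (simp_all add: induced_def)

lemma rtrancl_leaves_set:
  assumes "(u, v) \<in> r\<^sup>*" "u \<in> X" "v \<notin> X"
  shows "\<exists>x\<in>X. \<exists>y. y \<notin> X \<and> (x, y) \<in> r"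
  using assms by (induction rule: rtrancl_induct) blast+

text \<open>If \<open>v\<close> is unreachable from \<open>u\<close>, the vertices reachable from
  \<open>u\<close> form a cut that no edge crosses. This form is easier to use than walks when
  vertices are deleted, as in \<open>strip_connected\<close>.\<close>

lemma connected_graph_iff_cut:
  assumes "\<forall>e\<in>edges G. e \<subseteq> verts G"
  shows "connected_graph G \<longleftrightarrow> verts G \<noteq> {} \<and>
    (\<forall>X\<subseteq>verts G. X \<noteq> {} \<longrightarrow> X \<noteq> verts G \<longrightarrow> (\<exists>u\<in>X. \<exists>v\<in>verts G - X. {u, v} \<in> edges G))"
    (is "_ \<longleftrightarrow> _ \<and> ?cut")
proof (intro iffI conjI allI impI)
  show "verts G \<noteq> {}" if "connected_graph G"
    using that by (simp add: connected_graph_def)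
next
  fix X assume con: "connected_graph G" and X: "X \<subseteq> verts G" "X \<noteq> {}" "X \<noteq> verts G"
  then obtain u v where uv: "u \<in> X" "v \<in> verts G" "v \<notin> X"
    by blast
  then have "(u, v) \<in> (adj_rel G)\<^sup>*"
    using con X by (auto simp: connected_graph_def)
  from rtrancl_leaves_set[OF this uv(1,3)]
  show "\<exists>u\<in>X. \<exists>v\<in>verts G - X. {u, v} \<in> edges G"
    using assms by (fastforce simp: adj_rel_def)
next
  assume "verts G \<noteq> {} \<and> ?cut"
  then have ne: "verts G \<noteq> {}" and cut: ?cut
    by blast+
  have "(u, v) \<in> (adj_rel G)\<^sup>*" if "u \<in> verts G" "v \<in> verts G" for u v
  proof (rule ccontr)
    assume not: "(u, v) \<notin> (adj_rel G)\<^sup>*"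
    define X where "X = {x \<in> verts G. (u, x) \<in> (adj_rel G)\<^sup>*}"
    have "X \<subseteq> verts G" "X \<noteq> {}" "X \<noteq> verts G"
      using that not by (auto simp: X_def)
    then obtain x y where "x \<in> X" "y \<in> verts G - X" "{x, y} \<in> edges G"
      using cut by meson
    then show False
      by (auto simp: X_def adj_rel_def dest: rtrancl_into_rtrancl)
  qed
  then show "connected_graph G"
    using ne by (simp add: connected_graph_def)
qed

lemma connected_graph_cutD:
  assumes "connected_graph G" "\<forall>e\<in>edges G. e \<subseteq> verts G" "X \<subseteq> verts G" "X \<noteq> {}" "X \<noteq> verts G"
  obtains u v where "u \<in> X" "v \<in> verts G" "v \<notin> X" "{u, v} \<in> edges G"
  using assms connected_graph_iff_cut[of G] by blast

lemma connected_graph_cutI: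
  assumes "\<forall>e\<in>edges G. e \<subseteq> verts G" "verts G \<noteq> {}"
    and "\<And>X. X \<subseteq> verts G \<Longrightarrow> X \<noteq> {} \<Longrightarrow> X \<noteq> verts G \<Longrightarrow> \<exists>u\<in>X. \<exists>v\<in>verts G - X. {u, v} \<in> edges G"
  shows "connected_graph G"
  using assms connected_graph_iff_cut[of G] by blast

section \<open>Growing and restricting connected subgraphs\<close>

lemma connected_subgraphsD:
  assumes "H \<in> connected_subgraphs G"
  shows "verts H \<subseteq> verts G" "edges H \<subseteq> edges G" "\<forall>e\<in>edges H. e \<subseteq> verts H" "connected_graph H"
    "verts H \<noteq> {}"
  using assms by (auto simp: connected_subgraphs_def is_subgraph_def connected_graph_def)

lemma connected_subgraphsI:
  assumes "verts H \<subseteq> verts G" "edges H \<subseteq> edges G" "\<forall>e\<in>edges H. e \<subseteq> verts H" "connected_graph H"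
  shows "H \<in> connected_subgraphs G"
  using assms by (auto simp: connected_subgraphs_def is_subgraph_def)

lemma connected_graph_singleton: "connected_graph ({v}, {})"
  by (simp add: connected_graph_def)

text \<open>Every vertex of the enlarged graph is joined to \<open>u\<close> in both directions.
  This is the growth step behind \<open>connected_subgraph_of_size\<close> and
  \<open>glue_in_connected_subgraphs\<close>.\<close>

lemma connected_graph_attach:
  assumes "connected_graph H" "u \<in> verts H"
  shows "connected_graph (insert v (verts H), insert {u, v} (edges H))"
proof -
  let ?H = "(insert v (verts H), insert {u, v} (edges H))"
  have "adj_rel H \<subseteq> adj_rel ?H"
    by (auto simp: adj_rel_def)
  then have old: "(x, y) \<in> (adj_rel ?H)\<^sup>*" if "x \<in> verts H" "y \<in> verts H" for x y
    using assms(1) that rtrancl_mono[of "adj_rel H" "adj_rel ?H"] by (auto simp: connected_graph_def)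
  have "(u, v) \<in> adj_rel ?H" "(v, u) \<in> adj_rel ?H"
    by (auto simp: adj_rel_def insert_commute)
  then have "(x, u) \<in> (adj_rel ?H)\<^sup>*" "(u, x) \<in> (adj_rel ?H)\<^sup>*" if "x \<in> insert v (verts H)" for x
    using that old[OF _ assms(2)] old[OF assms(2)] by auto
  then have "(x, y) \<in> (adj_rel ?H)\<^sup>*" if "x \<in> insert v (verts H)" "y \<in> insert v (verts H)" for x y
    using that rtrancl_trans by metis
  then show ?thesis
    by (simp add: connected_graph_def)
qed

lemma connected_graph_add_edges:
  assumes "connected_graph (A, B)" "B \<subseteq> B'"
  shows "connected_graph (A, B')"
proof -
  have "adj_rel (A, B) \<subseteq> adj_rel (A, B')"
    using assms(2) by (auto simp: adj_rel_def)
  then show ?thesis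
    using assms(1) rtrancl_mono[of "adj_rel (A, B)" "adj_rel (A, B')"]
    by (auto simp: connected_graph_def)
qed

lemma induced_connected_insert:
  assumes "connected_graph (induced G X)" "u \<in> X" "{u, v} \<in> edges G"
  shows "connected_graph (induced G (insert v X))"
proof -
  have "connected_graph (insert v X, insert {u, v} {e \<in> edges G. e \<subseteq> X})"
    using connected_graph_attach[OF assms(1), of u v] assms(2) by simp
  then show ?thesis
    unfolding induced_def by (rule connected_graph_add_edges) (use assms in auto)
qed

lemma induced_in_connected_subgraphs:
  assumes "connected_graph (induced G X)" "X \<subseteq> verts G"
  shows "induced G X \<in> connected_subgraphs G"
  using assms by (intro connected_subgraphsI) auto

lemma induced_connected_of_subgraph:
  assumes "H \<in> connected_subgraphs G"
  shows "connected_graph (induced G (verts H))"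
  unfolding induced_def
  by (rule connected_graph_add_edges[of _ "edges H"]) (use connected_subgraphsD[OF assms] in auto)

lemma simple_graph_induced: "simple_graph G \<Longrightarrow> X \<subseteq> verts G \<Longrightarrow> simple_graph (induced G X)"
  by (auto simp: simple_graph_def intro: finite_subset)

lemma induced_induced: "Y \<subseteq> X \<Longrightarrow> induced (induced G X) Y = induced G Y"
  by (auto simp: induced_def)

lemma connected_subgraphs_induced:
  assumes "X \<subseteq> verts G"
  shows "connected_subgraphs (induced G X) = {H \<in> connected_subgraphs G. verts H \<subseteq> X}"
proof (intro set_eqI iffI)
  fix H assume "H \<in> {H \<in> connected_subgraphs G. verts H \<subseteq> X}"
  then show "H \<in> connected_subgraphs (induced G X)"
    using connected_subgraphsD[of H G]
    by (intro connected_subgraphsI) (simp_all add: subset_iff)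
next
  fix H assume "H \<in> connected_subgraphs (induced G X)"
  then show "H \<in> {H \<in> connected_subgraphs G. verts H \<subseteq> X}"
    using connected_subgraphsD[of H "induced G X"] assms by (auto intro!: connected_subgraphsI)
qed

lemma singleton_in_connected_subgraphs: "v \<in> verts G \<Longrightarrow> ({v}, {}) \<in> connected_subgraphs G"
  by (rule connected_subgraphsI) (auto simp: connected_graph_singleton)

lemma connected_subgraphs_attach:
  assumes "simple_graph G" "H \<in> connected_subgraphs G" "u \<in> verts H" "{u, v} \<in> edges G"
  shows "(insert v (verts H), insert {u, v} (edges H)) \<in> connected_subgraphs G"
  by (rule connected_subgraphsI)
    (use assms(1,4) connected_subgraphsD[OF assms(2)] connected_graph_attach[OF _ assms(3)] assms(3)
      in \<open>auto simp: simple_graph_def\<close>)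

lemma connected_subgraphs_extend:
  assumes "simple_graph G" "connected_graph G" "H \<in> connected_subgraphs G" "verts H \<noteq> verts G"
  obtains u v where "u \<in> verts H" "v \<in> verts G" "v \<notin> verts H" "{u, v} \<in> edges G"
    "(insert v (verts H), insert {u, v} (edges H)) \<in> connected_subgraphs G"
proof -
  note H = connected_subgraphsD[OF assms(3)]
  obtain u v where uv: "u \<in> verts H" "v \<in> verts G" "v \<notin> verts H" "{u, v} \<in> edges G"
    by (rule connected_graph_cutD[of G "verts H"]) (use assms H in \<open>auto simp: simple_graph_def\<close>)
  from connected_subgraphs_attach[OF assms(1,3) uv(1,4)] uv that show thesis by blast
qed

text \<open>Start from the single vertex \<open>v\<close> and repeatedly add a vertex across an edge
  that leaves the current vertex set.\<close>

lemma connected_subgraph_of_size: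
  assumes "simple_graph G" "connected_graph G" "v \<in> verts G" "1 \<le> s" "s \<le> card (verts G)"
  shows "\<exists>H\<in>connected_subgraphs G. v \<in> verts H \<and> card (verts H) = s"
  using assms(4,5)
proof (induction s rule: dec_induct)
  case base
  have "({v}, {}) \<in> connected_subgraphs G"
    by (rule singleton_in_connected_subgraphs[OF assms(3)])
  then show ?case by force
next
  case (step s)
  then obtain H where H: "H \<in> connected_subgraphs G" "v \<in> verts H" "card (verts H) = s"
    by auto
  then have "verts H \<noteq> verts G" using step by auto
  from connected_subgraphs_extend[OF assms(1,2) H(1) this] obtain u x where
    ux: "x \<notin> verts H" "(insert x (verts H), insert {u, x} (edges H)) \<in> connected_subgraphs G"
    by metis
  have "finite (verts H)"
    using connected_subgraphsD(1)[OF H(1)] assms(1) by (auto simp: simple_graph_def intro: finite_subset)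
  with ux H show ?case
    by (intro bexI[OF _ ux(2)]) auto
qed

text \<open>Growing yields a connected subgraph on all vertices but one, and the omitted vertex
  serves as \<open>v\<close>. Passing to the induced subgraph only adds edges.\<close>

lemma non_cut_vertex_exists:
  assumes "simple_graph G" "connected_graph G" "2 \<le> card (verts G)"
  obtains v where "v \<in> verts G" "connected_graph (induced G (verts G - {v}))"
proof -
  obtain x where "x \<in> verts G"
    using assms(2) by (auto simp: connected_graph_def)
  moreover have "1 \<le> card (verts G) - 1"
    using assms(3) by simp
  ultimately obtain H where H: "H \<in> connected_subgraphs G" "card (verts H) = card (verts G) - 1"
    using connected_subgraph_of_size[OF assms(1,2), of _ "card (verts G) - 1"] by (metis diff_le_self)
  have sub: "verts H \<subseteq> verts G" by (rule connected_subgraphsD[OF H(1)])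
  have "card (verts G - verts H) = 1"
    using H sub assms by (auto simp: card_Diff_subset simple_graph_def finite_subset)
  then obtain v where "verts G - verts H = {v}"
    by (auto simp: card_1_singleton_iff)
  then have "v \<in> verts G" "verts H = verts G - {v}"
    using sub by auto
  with that induced_connected_of_subgraph[OF H(1)] show thesis by metis
qed

text \<open>The order of a subgraph maps this family onto \<open>{1..card (verts G)}\<close>. When
  the cardinalities agree, the surjection is injective; this drives the equality case of
  \<open>card_connected_subgraphs_ge\<close>.\<close>

lemma card_connected_subgraphs_containing:
  assumes "simple_graph G" "connected_graph G" "v \<in> verts G"
  shows "card (verts G) \<le> card {H \<in> connected_subgraphs G. v \<in> verts H}"
    and "card (verts G) = card {H \<in> connected_subgraphs G. v \<in> verts H} \<Longrightarrow>
      inj_on (\<lambda>H. card (verts H)) {H \<in> connected_subgraphs G. v \<in> verts H}"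
proof -
  let ?C = "{H \<in> connected_subgraphs G. v \<in> verts H}"
  have fin: "finite ?C"
    using finite_connected_subgraphs[OF assms(1)] by simp
  have finG: "finite (verts G)"
    using assms(1) by (simp add: simple_graph_def)
  have img: "(\<lambda>H. card (verts H)) ` ?C = {1..card (verts G)}"
  proof
    have "1 \<le> card (verts H) \<and> card (verts H) \<le> card (verts G)" if "H \<in> connected_subgraphs G" for H
      using connected_subgraphsD[OF that] finG finite_subset[of "verts H" "verts G"]
      by (auto simp: card_mono Suc_le_eq card_gt_0_iff)
    then show "(\<lambda>H. card (verts H)) ` ?C \<subseteq> {1..card (verts G)}"
      by auto
    show "{1..card (verts G)} \<subseteq> (\<lambda>H. card (verts H)) ` ?C"
      using connected_subgraph_of_size[OF assms] by force
  qed
  show "card (verts G) \<le> card ?C"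
    using card_image_le[OF fin, of "\<lambda>H. card (verts H)"] img by simp
  show "inj_on (\<lambda>H. card (verts H)) ?C" if "card (verts G) = card ?C"
    by (rule eq_card_imp_inj_on[OF fin]) (unfold img, simp add: that)
qed

section \<open>Complementary pairs of connected sets\<close>

text \<open>Single sides are collected: a partition into two connected parts gives two members,
  hence the factor 2 in \<open>card_cut_sets_ge\<close>.\<close>

definition cut_sets :: "'a ugraph \<Rightarrow> 'a set set" where
  "cut_sets G = {X. X \<subseteq> verts G \<and> X \<noteq> {} \<and> X \<noteq> verts G \<and>
     connected_graph (induced G X) \<and> connected_graph (induced G (verts G - X))}"

lemma finite_cut_sets: "simple_graph G \<Longrightarrow> finite (cut_sets G)"
  by (rule finite_subset[of _ "Pow (verts G)"]) (auto simp: cut_sets_def simple_graph_def)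

lemma cut_sets_complement: "X \<in> cut_sets G \<Longrightarrow> verts G - X \<in> cut_sets G"
  by (auto simp: cut_sets_def double_diff)

lemma induced_singleton_connected: "connected_graph (induced G {v})"
  by (simp add: connected_graph_def)

lemma connected_graph_has_neighbour:
  assumes "simple_graph G" "connected_graph G" "v \<in> verts G" "2 \<le> card (verts G)"
  obtains u where "u \<in> verts G" "u \<noteq> v" "{u, v} \<in> edges G"
proof -
  have "{v} \<noteq> verts G" using assms(4) by (metis card_1_singleton_iff Suc_1 not_less_eq_eq One_nat_def le_refl)
  then obtain x u where "x \<in> {v}" "u \<in> verts G" "u \<notin> {v}" "{x, u} \<in> edges G"
    by (rule connected_graph_cutD[of G "{v}", rotated 4])
      (use assms in \<open>auto simp: simple_graph_def\<close>)
  then show thesis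
    by (intro that[of u]) (auto simp: insert_commute)
qed

text \<open>Delete a non-cut vertex $v$: a cut set of $G - v$ absorbs $v$ exactly if it contains a neighbour
  of $v$, and $\{v\}$ and its complement are two new cut sets.\<close>

lemma card_cut_sets_ge:
  assumes "simple_graph G" "connected_graph G"
  shows "2 * (card (verts G) - 1) \<le> card (cut_sets G)"
  using assms
proof (induction "card (verts G)" arbitrary: G rule: less_induct)
  case less
  show ?case
  proof (cases "card (verts G) \<le> 1")
    case False
    then have two: "2 \<le> card (verts G)" by simp
    obtain v where v: "v \<in> verts G" "connected_graph (induced G (verts G - {v}))"
      using non_cut_vertex_exists[OF less.prems two] .
    define V1 where "V1 = verts G - {v}"
    define G1 where "G1 = induced G V1"
    have vG1: "verts G1 = V1" by (simp add: G1_def)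
    have finG: "finite (verts G)" using less.prems by (simp add: simple_graph_def)
    have cardV1: "card V1 = card (verts G) - 1"
      using v(1) by (simp add: V1_def)
    have s1: "simple_graph G1" and c1: "connected_graph G1"
      using v(2) simple_graph_induced[OF less.prems(1)] by (simp_all add: G1_def V1_def)
    have ind1: "induced G1 X = induced G X" if "X \<subseteq> V1" for X
      using that by (simp add: G1_def induced_induced)
    have IH: "2 * (card V1 - 1) \<le> card (cut_sets G1)"
      using less.hyps[of G1] s1 c1 two cardV1 vG1 by simp
    obtain u where u: "u \<in> V1" "{u, v} \<in> edges G"
      using connected_graph_has_neighbour[OF less.prems v(1) two] by (auto simp: V1_def)
    define \<phi> where "\<phi> X = (if \<exists>x\<in>X. {x, v} \<in> edges G then insert v X else X)" for X
    \<comment> \<open>Deleting \<open>v\<close> undoes \<open>\<phi>\<close>, which gives its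
      injectivity below.\<close>
    have \<phi>: "\<phi> X - {v} = X" if "X \<in> cut_sets G1" for X
      using that by (auto simp: \<phi>_def cut_sets_def vG1 V1_def)
    have sub: "\<phi> ` cut_sets G1 \<subseteq> cut_sets G"
    proof (rule image_subsetI)
      fix X assume X: "X \<in> cut_sets G1"
      then have X1: "X \<subseteq> V1" "X \<noteq> {}" "X \<noteq> V1" "connected_graph (induced G X)"
        "connected_graph (induced G (V1 - X))"
        by (auto simp: cut_sets_def vG1 ind1)
      show "\<phi> X \<in> cut_sets G"
      proof (cases "\<exists>x\<in>X. {x, v} \<in> edges G")
        case True
        then have "connected_graph (induced G (insert v X))"
          using induced_connected_insert X1(4) by metis
        moreover have "verts G - insert v X = V1 - X" "insert v X \<subseteq> verts G" "insert v X \<noteq> verts G"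
          using X1 v(1) by (auto simp: V1_def)
        ultimately show ?thesis
          using True X1 by (simp add: \<phi>_def cut_sets_def)
      next
        case False
        \<comment> \<open>The neighbour \<open>u\<close> of \<open>v\<close> now lies on the other
          side, so that side can absorb \<open>v\<close> and stay connected.\<close>
        then have "u \<in> V1 - X" using u by auto
        then have "connected_graph (induced G (insert v (V1 - X)))"
          using induced_connected_insert X1(5) u(2) by metis
        moreover have "verts G - X = insert v (V1 - X)" "X \<subseteq> verts G" "X \<noteq> verts G"
          using X1 v(1) by (auto simp: V1_def)
        ultimately show ?thesis
          using False X1 by (simp add: \<phi>_def cut_sets_def)
      qed
    qed
    have inj: "inj_on \<phi> (cut_sets G1)"
      using \<phi> by (metis inj_onI)
    have "V1 \<noteq> {}" using u by auto
    have new: "{{v}, V1} \<subseteq> cut_sets G"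
      using v \<open>V1 \<noteq> {}\<close> induced_singleton_connected[of G v]
      by (auto simp: cut_sets_def V1_def double_diff)
    \<comment> \<open>Without \<open>v\<close> the two new sets become \<open>{}\<close> and
      \<open>V1\<close>, and neither is a cut set of \<open>G1\<close>.\<close>
    have disj: "{{v}, V1} \<inter> \<phi> ` cut_sets G1 = {}"
    proof -
      have "\<phi> X - {v} \<noteq> {}" "\<phi> X - {v} \<noteq> V1" if "X \<in> cut_sets G1" for X
        using \<phi>[OF that] that by (auto simp: cut_sets_def vG1)
      then show ?thesis by (auto simp: V1_def)
    qed
    have "{v} \<noteq> V1" by (auto simp: V1_def)
    then have "2 + card (cut_sets G1) = card ({{v}, V1} \<union> \<phi> ` cut_sets G1)"
      using disj finite_cut_sets[OF s1] by (subst card_Un_disjoint) (auto simp: card_image[OF inj])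
    also have "\<dots> \<le> card (cut_sets G)"
      using new sub by (intro card_mono finite_cut_sets less.prems) auto
    finally show ?thesis
      using IH cardV1 two by simp
  qed simp
qed

section \<open>Counting connected subgraphs\<close>

text \<open>Indices start at 1, matching the numbering of the path in \<open>T_tree\<close>.
  Injectivity of \<open>f\<close> on \<open>{1..d}\<close> is stated separately wherever a genuine
  path is meant.\<close>

definition path_graph :: "(nat \<Rightarrow> 'a) \<Rightarrow> nat \<Rightarrow> 'a ugraph" where
  "path_graph f d = (f ` {1..d}, {{f i, f (Suc i)} | i. 1 \<le> i \<and> i < d})"

lemma verts_path_graph [simp]: "verts (path_graph f d) = f ` {1..d}"
  by (simp add: path_graph_def)

lemma path_graph_cong: "(\<And>i. i \<in> {1..d} \<Longrightarrow> f i = g i) \<Longrightarrow> path_graph f d = path_graph g d"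
proof -
  assume eq: "\<And>i. i \<in> {1..d} \<Longrightarrow> f i = g i"
  then have "{f i, f (Suc i)} = {g i, g (Suc i)}" if "1 \<le> i" "i < d" for i
    using that by simp
  then have "{{f i, f (Suc i)} | i. 1 \<le> i \<and> i < d} = {{g i, g (Suc i)} | i. 1 \<le> i \<and> i < d}"
    by metis
  with eq show ?thesis
    by (simp add: path_graph_def)
qed

lemma path_graph_snoc:
  assumes "1 \<le> d"
  shows "path_graph f (Suc d)
    = (insert (f (Suc d)) (f ` {1..d}), insert {f d, f (Suc d)} (edges (path_graph f d)))"
proof -
  have "{1..Suc d} = insert (Suc d) {1..d}"
    by auto
  moreover have "{{f i, f (Suc i)} | i. 1 \<le> i \<and> i < Suc d}
      = insert {f d, f (Suc d)} {{f i, f (Suc i)} | i. 1 \<le> i \<and> i < d}"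
    unfolding less_Suc_eq using assms by blast
  ultimately show ?thesis
    by (simp add: path_graph_def)
qed

lemma inj_on_reverse:
  assumes "inj_on f {1..d}"
  shows "inj_on (\<lambda>i. f (Suc d - i)) {1..d}"
proof (rule inj_onI)
  fix x y assume xy: "x \<in> {1..d}" "y \<in> {1..d}" "f (Suc d - x) = f (Suc d - y)"
  have "Suc d - x = Suc d - y"
    by (rule inj_onD[OF assms xy(3)]) (use xy in auto)
  then show "x = y" using xy by auto
qed

text \<open>Lets either end of a path take the role of the end that an argument prefers.\<close>

lemma path_graph_reverse: "path_graph (\<lambda>i. f (Suc d - i)) d = path_graph f d"
proof -
  have v: "(\<lambda>i. f (Suc d - i)) ` {1..d} = f ` {1..d}"
  proof -
    have "x \<in> (\<lambda>i. Suc d - i) ` {1..d}" if "x \<in> {1..d}" for x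
      using that by (intro image_eqI[of _ _ "Suc d - x"]) auto
    then have "(\<lambda>i. Suc d - i) ` {1..d} = {1..d}"
      by auto
    then show ?thesis by (metis image_image)
  qed
  have "{f (Suc d - i), f (Suc d - Suc i)} \<in> {{f i, f (Suc i)} | i. 1 \<le> i \<and> i < d}"
    if "1 \<le> i" "i < d" for i
    using that by (intro CollectI exI[of _ "d - i"]) (auto simp: insert_commute Suc_diff_le)
  moreover have "{f i, f (Suc i)} \<in> {{f (Suc d - i), f (Suc d - Suc i)} | i. 1 \<le> i \<and> i < d}"
    if "1 \<le> i" "i < d" for i
    using that by (intro CollectI exI[of _ "d - i"]) (auto simp: insert_commute Suc_diff_le)
  ultimately show ?thesis
    unfolding path_graph_def v by auto
qed

lemma simple_graph_edgeE:
  assumes "simple_graph G" "e \<in> edges G" "v \<in> e"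
  obtains u where "e = {u, v}" "u \<noteq> v" "u \<in> verts G"
proof -
  have "card e = 2" "e \<subseteq> verts G"
    using assms by (auto simp: simple_graph_def)
  then obtain x y where "e = {x, y}" "x \<noteq> y" by (auto simp: card_2_iff)
  with assms(3) \<open>e \<subseteq> verts G\<close> that show thesis by (auto simp: insert_commute)
qed

section \<open>Lower bound on the number of connected subgraphs\<close>

lemma connected_subgraphs_split:
  assumes "v \<in> verts G"
  shows "connected_subgraphs G = connected_subgraphs (induced G (verts G - {v})) \<union>
    {H \<in> connected_subgraphs G. v \<in> verts H}"
    "connected_subgraphs (induced G (verts G - {v})) \<inter>
    {H \<in> connected_subgraphs G. v \<in> verts H} = {}"
  using connected_subgraphsD(1)[of _ G] by (auto simp: connected_subgraphs_induced)

text \<open>The vertex \<open>v\<close> receives the index \<open>Suc d\<close>. Its only edge is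
  \<open>{f d, v}\<close>, so all other edges already belong to the path \<open>f\<close>.\<close>

lemma pendant_extension_of_path:
  assumes G: "simple_graph G" and v: "v \<in> verts G"
    and f: "inj_on f {1..d}" "induced G (verts G - {v}) = path_graph f d"
    and u: "\<And>u. {u, v} \<in> edges G \<longleftrightarrow> u = f d" and d: "1 \<le> d"
  shows "\<exists>g. inj_on g {1..Suc d} \<and> G = path_graph g (Suc d)"
proof (intro exI conjI)
  let ?g = "f(Suc d := v)"
  have V: "f ` {1..d} = verts G - {v}"
    using arg_cong[OF f(2), of fst] by simp
  have vf: "v \<notin> f ` {1..d}"
    unfolding V by simp
  have img: "?g ` {1..d} = f ` {1..d}"
    by (rule image_cong) auto
  have ins: "{1..Suc d} = insert (Suc d) {1..d}"
    by auto
  show "inj_on ?g {1..Suc d}"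
    unfolding ins inj_on_insert using inj_on_fun_updI[OF f(1) vf] img vf by auto
  have E: "edges (path_graph f d) = {e \<in> edges G. v \<notin> e}"
    using G arg_cong[OF f(2), of snd] by (auto simp: simple_graph_def)
  have p: "path_graph ?g d = path_graph f d"
    by (rule path_graph_cong) auto
  have "edges G = insert {f d, v} {e \<in> edges G. v \<notin> e}"
  proof (intro equalityI subsetI)
    fix e assume e: "e \<in> edges G"
    show "e \<in> insert {f d, v} {e \<in> edges G. v \<notin> e}"
      using e u by (cases "v \<in> e") (metis insertI1 simple_graph_edgeE[OF G e], simp)
  qed (use u in auto)
  then show "G = path_graph ?g (Suc d)"
    using v by (subst path_graph_snoc[OF d]) (simp only: p E img V prod_eq_iff fst_conv snd_conv, auto)
qed

text \<open>For a non-cut vertex $v$, the connected subgraphs containing $v$ attain every size from $1$ to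
  the order of $G$. In the equality case each size occurs once; sizes $2$ and $3$ then show that $v$
  is attached to an end of the path $G - v$.\<close>

lemma card_connected_subgraphs_ge:
  assumes "simple_graph G" "connected_graph G"
  shows "card (verts G) * (card (verts G) + 1) \<le> 2 * card (connected_subgraphs G) \<and>
    (2 * card (connected_subgraphs G) = card (verts G) * (card (verts G) + 1) \<longrightarrow>
      (\<exists>f. inj_on f {1..card (verts G)} \<and> G = path_graph f (card (verts G))))"
  using assms
proof (induction "card (verts G)" arbitrary: G rule: less_induct)
  case less
  have finG: "finite (verts G)" using less.prems by (simp add: simple_graph_def)
  show ?case
  proof (cases "card (verts G) \<le> 1")
    case True
    then have "card (verts G) = 1"
      using less.prems finG by (simp add: connected_graph_def le_Suc_eq)
    then obtain x where x: "verts G = {x}" by (auto simp: card_1_singleton_iff)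
    have "{} = edges G"
    proof (rule ccontr)
      assume "{} \<noteq> edges G"
      then obtain e where "e \<in> edges G" by auto
      then have "e \<subseteq> {x}" "card e = 2" using less.prems x by (auto simp: simple_graph_def)
      then show False using card_mono[of "{x}" e] by simp
    qed
    then have "G = path_graph (\<lambda>_. x) 1"
      using x by (auto simp: path_graph_def prod_eq_iff)
    moreover have "card (connected_subgraphs G) \<ge> 1"
      using singleton_in_connected_subgraphs[of x G] x finite_connected_subgraphs[OF less.prems(1)]
      by (auto simp: Suc_le_eq card_gt_0_iff)
    ultimately show ?thesis
      using x by auto
  next
    case False
    then have two: "2 \<le> card (verts G)" by simp
    obtain v where v: "v \<in> verts G" "connected_graph (induced G (verts G - {v}))"
      using non_cut_vertex_exists[OF less.prems two] .
    define G1 where "G1 = induced G (verts G - {v})"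
    define C where "C = {H \<in> connected_subgraphs G. v \<in> verts H}"
    define d where "d = card (verts G) - 1"
    have d: "card (verts G) = Suc d" "1 \<le> d" "card (verts G1) = d"
      using two v(1) by (auto simp: d_def G1_def)
    have s1: "simple_graph G1" and c1: "connected_graph G1"
      using v(2) simple_graph_induced[OF less.prems(1)] by (simp_all add: G1_def)
    note IH = less.hyps[of G1, unfolded d, OF lessI s1 c1]
    have split: "card (connected_subgraphs G) = card (connected_subgraphs G1) + card C"
      using connected_subgraphs_split[OF v(1)] finite_connected_subgraphs[OF less.prems(1)]
        finite_connected_subgraphs[OF s1]
      by (metis (no_types, lifting) C_def G1_def card_Un_disjoint finite_Un)
    note C = card_connected_subgraphs_containing[OF less.prems v(1), folded C_def, unfolded d(1)]
    \<comment> \<open>Doubled triangular numbers: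
      \<open>d * (d + 1) + 2 * (d + 1) = (d + 1) * (d + 2)\<close>.\<close>
    have ge: "card (verts G) * (card (verts G) + 1) \<le> 2 * card (connected_subgraphs G)"
      using IH C(1) split d(1) by (simp add: algebra_simps)
    have "\<exists>f. inj_on f {1..Suc d} \<and> G = path_graph f (Suc d)"
      if eq: "2 * card (connected_subgraphs G) = card (verts G) * (card (verts G) + 1)"
    proof -
      \<comment> \<open>Both summands meet their lower bounds, so the induction hypothesis and the
        injectivity of the order on \<open>C\<close> become available.\<close>
      have "2 * card (connected_subgraphs G1) = d * (d + 1)" "Suc d = card C"
        using eq IH C(1) split d(1) by (auto simp: algebra_simps)
      with IH C(2) obtain f where f: "inj_on f {1..d}" "G1 = path_graph f d"
        and inj: "inj_on (\<lambda>H. card (verts H)) C"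
        by auto
      have V: "f ` {1..d} = verts G - {v}"
        using arg_cong[OF f(2), of fst] by (simp add: G1_def)
      obtain u where u: "u \<in> verts G" "u \<noteq> v" "{u, v} \<in> edges G"
        using connected_graph_has_neighbour[OF less.prems v(1) two] .
      have att: "(insert y (verts H), insert {x, y} (edges H)) \<in> C"
        if "H \<in> C" "x \<in> verts H" "{x, y} \<in> edges G" for H x y
        using connected_subgraphs_attach[OF less.prems(1)] that by (auto simp: C_def)
      have base: "({v}, {}) \<in> C"
        using singleton_in_connected_subgraphs[OF v(1)] by (simp add: C_def)
      have two_mem: "({x, v}, {{v, x}}) \<in> C" if "{x, v} \<in> edges G" for x
        using att[OF base, of v x] that by (simp add: insert_commute)
      \<comment> \<open>Each neighbour of \<open>v\<close> yields its own two-vertex member of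
        \<open>C\<close>, and there is only one of that order.\<close>
      have uniq: "{x, v} \<in> edges G \<longleftrightarrow> x = u" for x
      proof
        assume x: "{x, v} \<in> edges G"
        then have "x \<noteq> v" using less.prems(1) by (auto simp: simple_graph_def)
        then show "x = u"
          using inj_onD[OF inj _ two_mem[OF x] two_mem[OF u(3)]] u(2) by (auto simp: doubleton_eq_iff)
      qed (use u in simp)
      have "u \<in> f ` {1..d}" unfolding V using u by simp
      then obtain i where i: "i \<in> {1..d}" "u = f i" by blast
      have E: "{f j, f (Suc j)} \<in> edges G" if "1 \<le> j" "j < d" for j
      proof -
        have "{f j, f (Suc j)} \<in> edges G1" unfolding f(2) using that by (auto simp: path_graph_def)
        then show ?thesis by (simp add: G1_def)
      qed
      have "i = 1 \<or> i = d"
      proof (rule ccontr)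
        assume "\<not> ?thesis"
        \<comment> \<open>An interior \<open>u\<close> has path neighbours \<open>a\<close> and
          \<open>b\<close> on both sides. Adding either of them to the edge joining \<open>u\<close>
          and \<open>v\<close> gives two different members of \<open>C\<close> of order
          three.\<close>
        then have "1 < i" "i < d" using i by auto
        then obtain j where j: "i = Suc j" "1 \<le> j" "Suc j < d"
          by (cases i) auto
        define a b where "a = f j" and "b = f (Suc i)"
        have "a \<noteq> b" "a \<noteq> u" "b \<noteq> u"
          using j by (simp_all add: a_def b_def i(2) inj_on_eq_iff[OF f(1)])
        have "f m \<noteq> v" if "m \<in> {1..d}" for m
          using imageI[OF that, of f] unfolding V by simp
        then have "a \<noteq> v" "b \<noteq> v"
          using j by (simp_all add: a_def b_def)
        have "{u, a} \<in> edges G" "{u, b} \<in> edges G"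
          using E[of j] E[of i] j by (simp_all add: a_def b_def i(2) insert_commute)
        then have "(insert a {u, v}, insert {u, a} {{v, u}}) \<in> C" "(insert b {u, v}, insert {u, b} {{v, u}}) \<in> C"
          using att[OF two_mem[OF u(3)], of u] by simp_all
        from inj_onD[OF inj _ this] have "insert a {u, v} = insert b {u, v}"
          using \<open>a \<noteq> u\<close> \<open>b \<noteq> u\<close> \<open>a \<noteq> v\<close> \<open>b \<noteq> v\<close> u(2) by simp
        then show False
          using \<open>a \<noteq> b\<close> \<open>a \<noteq> u\<close> \<open>b \<noteq> u\<close> \<open>a \<noteq> v\<close> \<open>b \<noteq> v\<close> by blast
      qed
      then show ?thesis
      proof
        assume "i = d"
        then show ?thesis
          using pendant_extension_of_path[OF less.prems(1) v(1) f(1) f(2)[unfolded G1_def]] uniq i d(2) by auto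
      next
        assume "i = 1"
        let ?f = "\<lambda>i. f (Suc d - i)"
        have "inj_on ?f {1..d}"
          by (rule inj_on_reverse[OF f(1)])
        moreover have "induced G (verts G - {v}) = path_graph ?f d"
          unfolding path_graph_reverse[of f d] using f(2) unfolding G1_def .
        moreover have "{x, v} \<in> edges G \<longleftrightarrow> x = ?f d" for x
          using \<open>i = 1\<close> i by (simp add: uniq)
        ultimately show ?thesis
          using pendant_extension_of_path[OF less.prems(1) v(1), of ?f d] d(2) by blast
      qed
    qed
    then show ?thesis using ge d(1) by simp
  qed
qed

section \<open>Attaching pendant vertices\<close>

text \<open>The set \<open>P\<close> and the map \<open>nb\<close> are parameters, so that one count
  covers both an arbitrary graph with its pendant vertices and \<open>T_tree\<close> with explicit
  leaves and neighbours.\<close>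

locale pendant_attachment =
  fixes G :: "'a ugraph" and P :: "'a set" and nb :: "'a \<Rightarrow> 'a"
  assumes simple: "simple_graph G"
    and P_sub: "P \<subseteq> verts G"
    and nb: "p \<in> P \<Longrightarrow> nb p \<in> verts G - P"
    and edge_iff: "p \<in> P \<Longrightarrow> e \<in> edges G \<and> p \<in> e \<longleftrightarrow> e = {p, nb p}"
begin

definition core :: "'a ugraph" where
  "core = induced G (verts G - P)"

text \<open>The cardinality of this set is the weight w(A) of the proof idea.\<close>

definition hang :: "'a set \<Rightarrow> 'a set" where
  "hang A = {p \<in> P. nb p \<in> A}"

text \<open>Together with \<open>strip\<close> below this is the bijection behind the count: pairs
  of a connected subgraph \<open>H\<close> of the core and a subset \<open>Q\<close> of
  \<open>hang (verts H)\<close> correspond to the connected subgraphs of \<open>G\<close> not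
  contained in \<open>P\<close>.\<close>

definition glue :: "'a ugraph \<Rightarrow> 'a set \<Rightarrow> 'a ugraph" where
  "glue H Q = (verts H \<union> Q, edges H \<union> (\<lambda>p. {p, nb p}) ` Q)"

definition strip :: "'a ugraph \<Rightarrow> 'a ugraph" where
  "strip K = (verts K - P, {e \<in> edges K. e \<inter> P = {}})"

lemma finite_P: "finite P"
  using simple P_sub by (auto simp: simple_graph_def intro: finite_subset)

lemma simple_core: "simple_graph core"
  unfolding core_def by (rule simple_graph_induced[OF simple]) simp

lemma connected_subgraphs_core:
  "connected_subgraphs core = {H \<in> connected_subgraphs G. verts H \<inter> P = {}}"
proof -
  have "connected_subgraphs core = {H \<in> connected_subgraphs G. verts H \<subseteq> verts G - P}"
    unfolding core_def by (rule connected_subgraphs_induced) simp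
  also have "\<dots> = {H \<in> connected_subgraphs G. verts H \<inter> P = {}}"
    using connected_subgraphsD(1)[of _ G] by (intro Collect_cong) blast
  finally show ?thesis .
qed

lemma glue_in_connected_subgraphs:
  assumes "H \<in> connected_subgraphs core" "Q \<subseteq> hang (verts H)"
  shows "glue H Q \<in> connected_subgraphs G"
proof -
  have "finite Q"
    using assms(2) finite_P by (auto simp: hang_def intro: finite_subset)
  then show ?thesis
    using assms(2)
  proof (induction Q)
    case empty
    then show ?case using assms(1) by (simp add: glue_def connected_subgraphs_core)
  next
    case (insert p Q)
    then have p: "p \<in> P" "nb p \<in> verts (glue H Q)" and IH: "glue H Q \<in> connected_subgraphs G"
      by (simp_all add: hang_def glue_def)
    have "{nb p, p} \<in> edges G"
      using edge_iff[OF p(1), of "{nb p, p}"] by (simp add: insert_commute)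
    from connected_subgraphs_attach[OF simple IH p(2) this] show ?case
      by (simp add: glue_def insert_commute)
  qed
qed

lemma strip_glue:
  assumes "H \<in> connected_subgraphs core" "Q \<subseteq> hang (verts H)"
  shows "strip (glue H Q) = H" "verts (glue H Q) \<inter> P = Q"
proof -
  have H: "verts H \<inter> P = {}" "Q \<subseteq> P"
    using assms by (auto simp: connected_subgraphs_core hang_def)
  have "e \<inter> P = {}" if "e \<in> edges H" for e
    using that H connected_subgraphsD(3)[OF assms(1)] by blast
  then have "{e \<in> edges H \<union> (\<lambda>p. {p, nb p}) ` Q. e \<inter> P = {}} = edges H"
    using H(2) by auto
  moreover have "verts H \<union> Q - P = verts H"
    using H by blast
  ultimately show "strip (glue H Q) = H"
    by (simp add: strip_def glue_def)
  show "verts (glue H Q) \<inter> P = Q"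
    using H by (auto simp: glue_def)
qed

text \<open>Connectivity forces an edge of \<open>K\<close> out of \<open>{p}\<close>, and
  \<open>G\<close> has only one edge at \<open>p\<close>.\<close>

lemma pendant_edge_in_subgraph:
  assumes "K \<in> connected_subgraphs G" "\<not> verts K \<subseteq> P" "p \<in> verts K" "p \<in> P"
  shows "{p, nb p} \<in> edges K" "nb p \<in> verts K"
proof -
  note K = connected_subgraphsD[OF assms(1)]
  have "{p} \<noteq> verts K" "{p} \<subseteq> verts K"
    using assms by auto
  then obtain u v where "u \<in> {p}" "v \<in> verts K" "v \<notin> {p}" "{u, v} \<in> edges K"
    using connected_graph_cutD[OF K(4,3)] by blast
  then have "{p, v} \<in> edges K" "{p, v} = {p, nb p}"
    using edge_iff[OF assms(4), of "{p, v}"] K(2) by auto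
  then show "{p, nb p} \<in> edges K" by simp
  then show "nb p \<in> verts K" using K(3) by auto
qed

text \<open>A cut \<open>X\<close> of the stripped graph is enlarged by the pendant vertices of
  \<open>K\<close> hanging on it. An edge of \<open>K\<close> crossing the enlarged cut cannot meet
  \<open>P\<close>, because a vertex of \<open>P\<close> lies on the same side as its neighbour; so
  the edge survives in \<open>strip K\<close>.\<close>

lemma strip_connected:
  assumes "K \<in> connected_subgraphs G" "\<not> verts K \<subseteq> P"
  shows "strip K \<in> connected_subgraphs core"
proof -
  note K = connected_subgraphsD[OF assms(1)]
  have "connected_graph (strip K)"
  proof (rule connected_graph_cutI)
    show "\<forall>e\<in>edges (strip K). e \<subseteq> verts (strip K)"
      using K(3) by (auto simp: strip_def)
    show "verts (strip K) \<noteq> {}"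
      using assms(2) by (auto simp: strip_def)
    fix X assume X: "X \<subseteq> verts (strip K)" "X \<noteq> {}" "X \<noteq> verts (strip K)"
    define X' where "X' = X \<union> {p \<in> verts K \<inter> P. nb p \<in> X}"
    have XP: "X \<inter> P = {}" and XK: "X \<subseteq> verts K"
      using X by (auto simp: strip_def)
    have "X' \<subseteq> verts K" "X' \<noteq> {}" "X' \<noteq> verts K"
      using X by (auto simp: X'_def strip_def)
    then obtain u v where uv: "u \<in> X'" "v \<in> verts K" "v \<notin> X'" "{u, v} \<in> edges K"
      using connected_graph_cutD[OF K(4,3)] by metis
    have "u \<noteq> v" using uv by auto
    have "u \<notin> P"
    proof
      assume "u \<in> P"
      then have "{u, v} = {u, nb u}" using edge_iff[of u "{u, v}"] uv K(2) by auto
      then have "v = nb u" using \<open>u \<noteq> v\<close> by (auto simp: doubleton_eq_iff)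
      then show False using uv XP \<open>u \<in> P\<close> by (auto simp: X'_def)
    qed
    moreover have "v \<notin> P"
    proof
      assume "v \<in> P"
      then have "{u, v} = {v, nb v}" using edge_iff[of v "{u, v}"] uv K(2) by auto
      then have "u = nb v" using \<open>u \<noteq> v\<close> by (auto simp: doubleton_eq_iff)
      then show False using uv \<open>u \<notin> P\<close> \<open>v \<in> P\<close> by (auto simp: X'_def)
    qed
    ultimately have "u \<in> X" "v \<in> verts (strip K) - X" "{u, v} \<in> edges (strip K)"
      using uv by (auto simp: X'_def strip_def)
    then show "\<exists>u\<in>X. \<exists>v\<in>verts (strip K) - X. {u, v} \<in> edges (strip K)"
      by blast
  qed
  then have "strip K \<in> connected_subgraphs G"
    by (intro connected_subgraphsI) (use K in \<open>auto simp: strip_def\<close>)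
  then show ?thesis
    by (auto simp: connected_subgraphs_core strip_def)
qed

lemma glue_strip:
  assumes "K \<in> connected_subgraphs G" "\<not> verts K \<subseteq> P"
  shows "glue (strip K) (verts K \<inter> P) = K" "verts K \<inter> P \<subseteq> hang (verts (strip K))"
proof -
  note K = connected_subgraphsD[OF assms(1)]
  note pe = pendant_edge_in_subgraph[OF assms]
  have "edges K \<subseteq> edges (strip K) \<union> (\<lambda>p. {p, nb p}) ` (verts K \<inter> P)"
  proof
    fix e assume e: "e \<in> edges K"
    show "e \<in> edges (strip K) \<union> (\<lambda>p. {p, nb p}) ` (verts K \<inter> P)"
    proof (cases "e \<inter> P = {}")
      case False
      then obtain p where "p \<in> e" "p \<in> P" by auto
      then have "e = {p, nb p}" "p \<in> verts K"
        using edge_iff[of p e] e K(2,3) by auto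
      then show ?thesis using \<open>p \<in> P\<close> by auto
    qed (use e in \<open>simp add: strip_def\<close>)
  qed
  moreover have "edges (strip K) \<union> (\<lambda>p. {p, nb p}) ` (verts K \<inter> P) \<subseteq> edges K"
    using pe(1) by (auto simp: strip_def)
  moreover have "verts (strip K) \<union> (verts K \<inter> P) = verts K"
    by (auto simp: strip_def)
  ultimately show "glue (strip K) (verts K \<inter> P) = K"
    by (simp add: glue_def prod_eq_iff subset_antisym)
  show "verts K \<inter> P \<subseteq> hang (verts (strip K))"
    using pe(2) nb by (auto simp: hang_def strip_def)
qed

text \<open>Any edge at a vertex of \<open>P\<close> ends outside \<open>P\<close>, so
  \<open>K\<close> has no edges and, being connected, a single vertex.\<close>

lemma subgraph_of_pendants:
  assumes "K \<in> connected_subgraphs G" "verts K \<subseteq> P"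
  shows "K \<in> (\<lambda>p. ({p}, {})) ` P"
proof -
  note K = connected_subgraphsD[OF assms(1)]
  have E: "edges K = {}"
  proof (rule ccontr)
    assume "edges K \<noteq> {}"
    then obtain e where e: "e \<in> edges K" by auto
    then have "card e = 2" using K(2) simple by (auto simp: simple_graph_def)
    then obtain p where "p \<in> e" by fastforce
    then have "p \<in> P" using e K(3) assms(2) by auto
    then have "e = {p, nb p}" using edge_iff[of p e] e \<open>p \<in> e\<close> K(2) by auto
    then have "nb p \<in> verts K" using e K(3) by blast
    then show False using nb[OF \<open>p \<in> P\<close>] assms(2) by blast
  qed
  obtain p where p: "p \<in> verts K" using K(5) by auto
  have "verts K = {p}"
  proof (rule ccontr)
    assume "verts K \<noteq> {p}"
    then obtain u v where "{u, v} \<in> edges K"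
      using connected_graph_cutD[OF K(4,3), of "{p}"] p by blast
    then show False using E by simp
  qed
  then have "K = ({p}, {})"
    using E by (simp add: prod_eq_iff)
  moreover have "p \<in> P" using p assms(2) by auto
  ultimately show ?thesis by simp
qed

text \<open>The single pendant vertices give \<open>card P\<close>. All other connected subgraphs
  are counted through \<open>glue\<close>, with one choice of a subset of
  \<open>hang (verts H)\<close> for each \<open>H\<close>.\<close>

lemma core_index_eq:
  "core_index G = card P + (\<Sum>H\<in>connected_subgraphs core. 2 ^ card (hang (verts H)))"
proof -
  let ?S = "SIGMA H : connected_subgraphs core. Pow (hang (verts H))"
  let ?g = "\<lambda>(H, Q). glue H Q"
  let ?P = "(\<lambda>p. ({p}, {}) :: 'a ugraph) ` P"
  have fin: "finite (connected_subgraphs core)"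
    by (rule finite_connected_subgraphs[OF simple_core])
  have finh: "finite (hang A)" for A
    using finite_P by (simp add: hang_def)
  have "connected_subgraphs G = ?P \<union> ?g ` ?S"
  proof (intro equalityI subsetI)
    fix K assume K: "K \<in> connected_subgraphs G"
    show "K \<in> ?P \<union> ?g ` ?S"
    proof (cases "verts K \<subseteq> P")
      case True
      then show ?thesis using subgraph_of_pendants[OF K] by blast
    next
      case False
      then have "(strip K, verts K \<inter> P) \<in> ?S" "K = ?g (strip K, verts K \<inter> P)"
        using glue_strip[OF K] strip_connected[OF K] by simp_all
      then show ?thesis by blast
    qed
  next
    fix K assume "K \<in> ?P \<union> ?g ` ?S"
    then show "K \<in> connected_subgraphs G"
    proof (elim UnE imageE)
      fix p assume "K = ({p}, {})" "p \<in> P"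
      then show ?thesis using singleton_in_connected_subgraphs[of p G] P_sub by blast
    next
      fix x assume "K = ?g x" "x \<in> ?S"
      then show ?thesis using glue_in_connected_subgraphs by (cases x) simp
    qed
  qed
  moreover have "?P \<inter> ?g ` ?S = {}"
  proof -
    have not: "\<not> verts (glue H Q) \<subseteq> P" if "H \<in> connected_subgraphs core" for H Q
      using that connected_subgraphsD(5)[OF that] by (auto simp: connected_subgraphs_core glue_def)
    have "\<not> verts K \<subseteq> P" if "K \<in> ?g ` ?S" for K
    proof -
      from that obtain x where "K = ?g x" "x \<in> ?S" by (rule imageE)
      then show ?thesis using not by (cases x) simp
    qed
    moreover have "verts K \<subseteq> P" if "K \<in> ?P" for K
      using that by (elim imageE) simp
    ultimately show ?thesis by blast
  qed
  moreover have "finite ?S"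
    using fin finh by auto
  ultimately have "core_index G = card ?P + card (?g ` ?S)"
    unfolding core_index_def using finite_P by (simp add: card_Un_disjoint)
  moreover have "card ?P = card P"
    by (rule card_image) (auto simp: inj_on_def)
  moreover have "inj_on ?g ?S"
  proof (rule inj_on_inverseI[of _ "\<lambda>K. (strip K, verts K \<inter> P)"])
    fix x assume "x \<in> ?S"
    then show "(strip (?g x), verts (?g x) \<inter> P) = x"
      using strip_glue by (cases x) simp
  qed
  then have "card (?g ` ?S) = (\<Sum>H\<in>connected_subgraphs core. 2 ^ card (hang (verts H)))"
    using fin finh by (simp add: card_image card_Pow)
  ultimately show ?thesis by simp
qed

text \<open>Apply \<open>strip_connected\<close> to \<open>G\<close> as a subgraph of itself;
  stripping it gives the core.\<close>

lemma connected_core: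
  assumes "connected_graph G" "verts G \<noteq> P"
  shows "connected_graph core"
proof -
  have G: "G \<in> connected_subgraphs G"
    using assms simple by (intro connected_subgraphsI) (auto simp: simple_graph_def)
  then have "strip G \<in> connected_subgraphs core"
    using strip_connected[OF G] assms(2) P_sub by blast
  moreover have "edges (strip G) = edges core"
    using simple by (auto simp: strip_def core_def simple_graph_def)
  then have "strip G = core"
    by (simp add: prod_eq_iff) (simp add: strip_def core_def)
  ultimately show ?thesis
    using connected_subgraphsD(4) by metis
qed

lemma card_hang_complement:
  assumes "X \<subseteq> verts core"
  shows "card (hang X) + card (hang (verts core - X)) = card P"
proof -
  have "hang X \<union> hang (verts core - X) = P" "hang X \<inter> hang (verts core - X) = {}"
    using nb by (auto simp: hang_def core_def)
  then show ?thesis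
    using finite_P by (metis card_Un_disjoint finite_Un)
qed

end

section \<open>The weighted count\<close>

text \<open>For \<open>x \<le> y\<close> write the two halves of \<open>k\<close> as
  \<open>x + s\<close> and \<open>x + t\<close>, so that \<open>y = x + s + t\<close>. The
  difference of the two sums is then \<open>2 ^ x * ((2 ^ s - 1) * (2 ^ t - 1))\<close>, which
  vanishes only if \<open>s\<close> or \<open>t\<close> does.\<close>

lemma balanced_power_sum:
  fixes x y k :: nat
  assumes "x + y = k"
  shows "(2::nat) ^ (k div 2) + 2 ^ ((k + 1) div 2) \<le> 2 ^ x + 2 ^ y"
    and "(2::nat) ^ (k div 2) + 2 ^ ((k + 1) div 2) = 2 ^ x + 2 ^ y \<Longrightarrow>
      x = k div 2 \<or> x = (k + 1) div 2"
proof -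
  have *: "(2::nat) ^ (k div 2) + 2 ^ ((k + 1) div 2) \<le> 2 ^ x + 2 ^ y \<and>
    ((2::nat) ^ (k div 2) + 2 ^ ((k + 1) div 2) = 2 ^ x + 2 ^ y \<longrightarrow> x = k div 2 \<and> y = (k + 1) div 2)"
    if "x \<le> y" "x + y = k" for x y
  proof -
    define s t where "s = k div 2 - x" and "t = (k + 1) div 2 - x"
    have st: "k div 2 = x + s" "(k + 1) div 2 = x + t" "y = x + s + t" "s \<le> t"
      using that by (auto simp: s_def t_def)
    obtain p q where pq: "(2::nat) ^ s = 1 + p" "(2::nat) ^ t = 1 + q"
      by (metis add_diff_inverse_nat less_one not_one_le_zero one_le_numeral one_le_power linorder_not_less)
    have "(2::nat) ^ x + 2 ^ y = 2 ^ (k div 2) + 2 ^ ((k + 1) div 2) + 2 ^ x * (p * q)"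
      unfolding st power_add pq by (simp add: algebra_simps)
    moreover have "x = k div 2 \<and> y = (k + 1) div 2" if "p * q = 0"
    proof -
      have "s = 0 \<or> t = 0"
        using that pq by (cases s; cases t) auto
      then show ?thesis using st by auto
    qed
    ultimately show ?thesis by auto
  qed
  show "(2::nat) ^ (k div 2) + 2 ^ ((k + 1) div 2) \<le> 2 ^ x + 2 ^ y"
    using *[of x y] *[of y x] assms by (cases "x \<le> y") auto
  show "x = k div 2 \<or> x = (k + 1) div 2"
    if "(2::nat) ^ (k div 2) + 2 ^ ((k + 1) div 2) = 2 ^ x + 2 ^ y"
    using *[of x y] *[of y x] assms that by (cases "x \<le> y") auto
qed

text \<open>Here \<open>m\<close> counts the cut sets and \<open>s\<close> is their total weight,
  \<open>q\<close> and \<open>r\<close> are the number and weight of the remaining proper subgraphs,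
  and \<open>n\<close> counts all connected subgraphs. Each cut set beyond
  \<open>2 * (d - 1)\<close> lowers the bound on \<open>2 * q\<close> by 2 but raises the bound on
  \<open>2 * s\<close> by \<open>c\<close>, a gain of at least 1. Everything is doubled to avoid
  halves.\<close>

lemma weighted_count_arith:
  fixes d c :: nat
  assumes "2 \<le> d" "3 \<le> c" "2 * (d - 1) \<le> m" "m * c \<le> 2 * s" "q \<le> r" "n = 1 + m + q"
    "d * (d + 1) \<le> 2 * n"
  shows "2 * (d - 1) * c + (d - 1) * (d - 2) \<le> 2 * s + 2 * r"
    and "2 * s + 2 * r = 2 * (d - 1) * c + (d - 1) * (d - 2) \<Longrightarrow>
      m * c = 2 * s \<and> q = r \<and> 2 * n = d * (d + 1)"
proof -
  obtain e where e: "d = e + 2" using assms(1) by (metis le_add_diff_inverse2)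
  obtain c' where c': "c = c' + 2" by (rule that[of "c - 2"]) (use assms(2) in simp)
  obtain m' where m': "m = 2 * (d - 1) + m'" using assms(3) by (metis le_add_diff_inverse)
  have "m * c = 2 * (d - 1) * c + m' * c' + 2 * m'"
    by (simp add: m' c' algebra_simps)
  moreover have "d * (d + 1) = (d - 1) * (d - 2) + 2 + 4 * (d - 1)"
    by (simp add: e algebra_simps)
  ultimately show "2 * (d - 1) * c + (d - 1) * (d - 2) \<le> 2 * s + 2 * r"
    and "2 * s + 2 * r = 2 * (d - 1) * c + (d - 1) * (d - 2) \<Longrightarrow>
      m * c = 2 * s \<and> q = r \<and> 2 * n = d * (d + 1)"
    using assms(4-7) m' by linarith+
qed

lemma inj_on_induced: "inj_on (induced G) A"
  by (auto simp: inj_on_def induced_def)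

text \<open>The weight is abstract; all that is asked of it is that complementary sets share the
  total \<open>k\<close>. In the application it is the number of pendant vertices hanging on a
  set.\<close>

lemma weighted_subgraph_sum:
  fixes W :: "'a set \<Rightarrow> nat"
  assumes G: "simple_graph G" "connected_graph G" and d: "card (verts G) = d" "2 \<le> d"
    and W: "W (verts G) = k" "\<forall>X\<subseteq>verts G. W X + W (verts G - X) = k" and k: "2 \<le> k"
  defines "c \<equiv> 2 ^ (k div 2) + 2 ^ ((k + 1) div 2) :: nat"
  shows "2 * 2 ^ k + 2 * (d - 1) * c + (d - 1) * (d - 2)
      \<le> 2 * (\<Sum>H\<in>connected_subgraphs G. 2 ^ W (verts H))"
    and "2 * (\<Sum>H\<in>connected_subgraphs G. 2 ^ W (verts H))
        = 2 * 2 ^ k + 2 * (d - 1) * c + (d - 1) * (d - 2) \<Longrightarrow>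
      (\<exists>f. inj_on f {1..d} \<and> G = path_graph f d) \<and>
      (\<forall>X\<in>cut_sets G. W X = k div 2 \<or> W X = (k + 1) div 2) \<and>
      (\<forall>X\<subseteq>verts G. connected_graph (induced G X) \<longrightarrow> X \<notin> cut_sets G \<longrightarrow> X \<noteq> verts G \<longrightarrow> W X = 0)"
proof -
  let ?C = "connected_subgraphs G" and ?w = "\<lambda>H. (2::nat) ^ W (verts H)"
  \<comment> \<open>Only the induced subgraph on each cut set enters \<open>D\<close>. Other
    connected subgraphs with the same vertex set fall into the remainder, where 1 is a sufficient
    lower bound.\<close>
  define D where "D = insert G (induced G ` cut_sets G)"
  define s where "s = (\<Sum>X\<in>cut_sets G. (2::nat) ^ W X)"
  define r where "r = (\<Sum>H\<in>?C - D. ?w H)"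
  have finC: "finite ?C" and fincut: "finite (cut_sets G)"
    using finite_connected_subgraphs[OF G(1)] finite_cut_sets[OF G(1)] .
  have finD: "finite D" using fincut by (simp add: D_def)
  have "G \<in> ?C"
    using G by (intro connected_subgraphsI) (auto simp: simple_graph_def)
  then have DC: "D \<subseteq> ?C"
    using induced_in_connected_subgraphs[of G]
    unfolding D_def cut_sets_def insert_subset image_subset_iff by blast
  have GD: "G \<notin> induced G ` cut_sets G"
  proof
    assume "G \<in> induced G ` cut_sets G"
    then obtain X where X: "G = induced G X" "X \<in> cut_sets G" by (rule imageE)
    from arg_cong[OF X(1), of fst] X(2) show False by (simp add: cut_sets_def)
  qed
  have cardD: "card D = 1 + card (cut_sets G)"
    using GD fincut by (simp add: D_def card_image[OF inj_on_induced])
  have sumD: "(\<Sum>H\<in>D. ?w H) = 2 ^ k + s"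
    using GD fincut W(1) by (simp add: D_def s_def sum.reindex[OF inj_on_induced])
  have total: "(\<Sum>H\<in>?C. ?w H) = 2 ^ k + s + r"
    using sum.subset_diff[OF DC finC, of ?w] sumD by (simp add: r_def)
  \<comment> \<open>Complementation permutes the cut sets, so \<open>2 * s\<close> becomes a sum
    over complementary pairs.\<close>
  have compl: "bij_betw (\<lambda>X. verts G - X) (cut_sets G) (cut_sets G)"
    by (rule bij_betw_byWitness[of _ "\<lambda>X. verts G - X"])
      (auto simp: cut_sets_complement, auto simp: cut_sets_def)
  have two_s: "2 * s = (\<Sum>X\<in>cut_sets G. 2 ^ W X + 2 ^ W (verts G - X))"
    using sum.reindex_bij_betw[OF compl, of "\<lambda>X. (2::nat) ^ W X"]
    by (simp add: s_def sum.distrib)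
  have bal: "c \<le> 2 ^ W X + 2 ^ W (verts G - X)"
    "c = 2 ^ W X + 2 ^ W (verts G - X) \<Longrightarrow> W X = k div 2 \<or> W X = (k + 1) div 2"
    if "X \<in> cut_sets G" for X
    using balanced_power_sum[OF W(2)[rule_format], of X] that unfolding c_def by (auto simp: cut_sets_def)
  have ms: "card (cut_sets G) * c \<le> 2 * s"
    unfolding two_s using sum_bounded_below[of "cut_sets G" c] bal(1) by fastforce
  have "(2::nat) ^ 1 \<le> 2 ^ (k div 2)" "(2::nat) ^ 1 \<le> 2 ^ ((k + 1) div 2)"
    by (rule power_increasing; use k in simp)+
  then have c3: "3 \<le> c" by (simp add: c_def)
  have qr: "card (?C - D) \<le> r"
    unfolding r_def using sum_bounded_below[of "?C - D" 1 ?w] by simp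
  have n: "card ?C = 1 + card (cut_sets G) + card (?C - D)"
    using cardD card_Diff_subset[OF finD DC] card_mono[OF finC DC] by simp
  note CS = card_connected_subgraphs_ge[OF G, unfolded d(1)]
  note cuts = card_cut_sets_ge[OF G, unfolded d(1)]
  note ar = weighted_count_arith[OF d(2) c3 cuts ms qr n conjunct1[OF CS]]
  show "2 * 2 ^ k + 2 * (d - 1) * c + (d - 1) * (d - 2) \<le> 2 * (\<Sum>H\<in>?C. ?w H)"
    using ar(1) total by simp
  assume "2 * (\<Sum>H\<in>?C. ?w H) = 2 * 2 ^ k + 2 * (d - 1) * c + (d - 1) * (d - 2)"
  then have eq: "card (cut_sets G) * c = 2 * s" "card (?C - D) = r" "2 * card ?C = d * (d + 1)"
    using ar(2) total by simp_all
  \<comment> \<open>Each term is at least \<open>c\<close> and the total is exactly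
    \<open>card (cut_sets G) * c\<close>, so no term can exceed \<open>c\<close>.\<close>
  have "c = 2 ^ W X + 2 ^ W (verts G - X)" if "X \<in> cut_sets G" for X
  proof (rule ccontr)
    assume "c \<noteq> 2 ^ W X + 2 ^ W (verts G - X)"
    then have "c < 2 ^ W X + 2 ^ W (verts G - X)"
      using bal(1)[OF that] by simp
    then have "(\<Sum>X\<in>cut_sets G. c) < (\<Sum>X\<in>cut_sets G. 2 ^ W X + 2 ^ W (verts G - X))"
      using bal(1) that fincut by (intro sum_strict_mono_ex1) blast+
    then show False using eq(1) two_s by simp
  qed
  then have b: "W X = k div 2 \<or> W X = (k + 1) div 2" if "X \<in> cut_sets G" for X
    using bal(2) that by blast
  have "W (verts H) = 0" if "H \<in> ?C - D" for H
  proof (rule ccontr)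
    assume "W (verts H) \<noteq> 0"
    then have "1 < ?w H" by (intro one_less_power) simp_all
    then have "(\<Sum>H\<in>?C - D. 1) < (\<Sum>H\<in>?C - D. ?w H)"
      using that finC by (intro sum_strict_mono_ex1) auto
    then show False using eq(2) by (simp add: r_def)
  qed
  \<comment> \<open>To transfer weight zero from the remaining subgraphs to vertex sets,
    \<open>X\<close> is represented by its induced subgraph; different sets induce different graphs,
    which keeps it outside \<open>D\<close>.\<close>
  moreover have "induced G X \<in> ?C - D"
    if "X \<subseteq> verts G" "connected_graph (induced G X)" "X \<notin> cut_sets G" "X \<noteq> verts G" for X
  proof -
    have "induced G X \<noteq> G"
    proof
      assume "induced G X = G"
      from arg_cong[OF this, of fst] that(4) show False by simp
    qed
    moreover have "induced G X \<notin> induced G ` cut_sets G"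
      using that(3) inj_on_induced[of G UNIV] by (simp add: inj_image_mem_iff)
    ultimately show ?thesis
      using induced_in_connected_subgraphs[OF that(2,1)] by (simp add: D_def)
  qed
  ultimately have "W X = 0"
    if "X \<subseteq> verts G" "connected_graph (induced G X)" "X \<notin> cut_sets G" "X \<noteq> verts G" for X
    using that induced_simps(1) by metis
  with b CS eq(3)
  show "(\<exists>f. inj_on f {1..d} \<and> G = path_graph f d) \<and>
      (\<forall>X\<in>cut_sets G. W X = k div 2 \<or> W X = (k + 1) div 2) \<and>
      (\<forall>X\<subseteq>verts G. connected_graph (induced G X) \<longrightarrow> X \<notin> cut_sets G \<longrightarrow> X \<noteq> verts G \<longrightarrow> W X = 0)"
    by blast
qed

section \<open>Isomorphism invariance\<close>

lemma isomorphic_of_edge_image: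
  assumes f: "bij_betw f (verts G) (verts H)" and E: "edges H = image f ` edges G"
    and sub: "\<forall>e\<in>edges G. e \<subseteq> verts G"
  shows "isomorphic G H"
  unfolding isomorphic_def
proof (intro exI conjI ballI)
  fix u v assume uv: "u \<in> verts G" "v \<in> verts G"
  have inj: "inj_on (image f) (Pow (verts G))"
    using bij_betw_imp_inj_on[OF f] by (rule inj_on_image_Pow)
  have "{f u, f v} = f ` {u, v}" by simp
  also have "\<dots> \<in> image f ` edges G \<longleftrightarrow> {u, v} \<in> edges G"
    by (rule inj_on_image_mem_iff[OF inj]) (use uv sub in auto)
  finally show "{u, v} \<in> edges G \<longleftrightarrow> {f u, f v} \<in> edges H"
    by (simp add: E)
qed (rule f)

lemma simple_graph_endpointsE:
  assumes "simple_graph G" "e \<in> edges G"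
  obtains u v where "e = {u, v}" "u \<noteq> v" "u \<in> verts G" "v \<in> verts G"
proof -
  have "card e = 2" "e \<subseteq> verts G"
    using assms by (auto simp: simple_graph_def)
  then show thesis
    using that by (auto simp: card_2_iff)
qed

text \<open>In simple graphs every edge is a pair of vertices, so preserving adjacency determines
  the edge set. The image form transports whole subgraphs at once.\<close>

lemma isomorphic_edge_image:
  assumes "isomorphic G H" "simple_graph G" "simple_graph H"
  obtains f where "bij_betw f (verts G) (verts H)" "edges H = image f ` edges G"
proof -
  from assms(1) obtain f where f: "bij_betw f (verts G) (verts H)"
    and E: "\<And>u v. u \<in> verts G \<Longrightarrow> v \<in> verts G \<Longrightarrow> {u, v} \<in> edges G \<longleftrightarrow> {f u, f v} \<in> edges H"
    by (auto simp: isomorphic_def)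
  have "f ` e \<in> edges H" if e: "e \<in> edges G" for e
  proof -
    obtain u v where "e = {u, v}" "u \<in> verts G" "v \<in> verts G"
      using simple_graph_endpointsE[OF assms(2) e] by metis
    then show ?thesis using E e by simp
  qed
  moreover have "e \<in> image f ` edges G" if e: "e \<in> edges H" for e
  proof -
    obtain x y where xy: "e = {x, y}" "x \<in> verts H" "y \<in> verts H"
      using simple_graph_endpointsE[OF assms(3) e] by metis
    then obtain u v where "u \<in> verts G" "v \<in> verts G" "x = f u" "y = f v"
      using bij_betw_imp_surj_on[OF f] by blast
    then have "{u, v} \<in> edges G" "e = f ` {u, v}" using E e xy(1) by auto
    then show ?thesis by blast
  qed
  ultimately have "edges H = image f ` edges G" by blast
  with f that show thesis by blast
qed

lemma isomorphic_sym:
  assumes "isomorphic G H" "simple_graph G" "simple_graph H"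
  shows "isomorphic H G"
proof -
  obtain f where f: "bij_betw f (verts G) (verts H)" and E: "edges H = image f ` edges G"
    using isomorphic_edge_image[OF assms] .
  let ?g = "inv_into (verts G) f"
  have "?g ` f ` e = e" if "e \<in> edges G" for e
    using assms(2) that bij_betw_imp_inj_on[OF f] by (simp add: simple_graph_def)
  then have "edges G = image ?g ` edges H"
    by (simp add: E image_image)
  then show ?thesis
    using assms(3) by (intro isomorphic_of_edge_image[OF bij_betw_inv_into[OF f]])
      (auto simp: simple_graph_def)
qed

lemma connected_graph_image:
  assumes "connected_graph K"
  shows "connected_graph (f ` verts K, image f ` edges K)"
proof -
  let ?K = "(f ` verts K, image f ` edges K)"
  have "(f u, f v) \<in> (adj_rel ?K)\<^sup>*" if "(u, v) \<in> (adj_rel K)\<^sup>*" for u v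
    using that
  proof (induction rule: rtrancl_induct)
    case (step y z)
    have "f ` {y, z} \<in> image f ` edges K"
      using step(2) unfolding adj_rel_def by blast
    then have "(f y, f z) \<in> adj_rel ?K" by (simp add: adj_rel_def)
    with step show ?case by simp
  qed simp
  then show ?thesis
    using assms by (simp add: connected_graph_def)
qed

lemma core_index_le_of_isomorphic:
  assumes "isomorphic G H" "simple_graph G" "simple_graph H"
  shows "core_index G \<le> core_index H"
proof -
  obtain f where f: "bij_betw f (verts G) (verts H)" and E: "edges H = image f ` edges G"
    using isomorphic_edge_image[OF assms] .
  let ?m = "\<lambda>K. (f ` verts K, image f ` edges K)"
  have inj1: "inj_on (image f) (Pow (verts G))"
    using bij_betw_imp_inj_on[OF f] by (rule inj_on_image_Pow)
  \<comment> \<open>An edge set is a set of sets, so injectivity of \<open>f\<close> has to be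
    lifted twice.\<close>
  have inj2: "inj_on (image (image f)) (Pow (Pow (verts G)))"
    using inj1 by (rule inj_on_image_Pow)
  show ?thesis
    unfolding core_index_def
  proof (rule card_inj_on_le)
    show "finite (connected_subgraphs H)"
      by (rule finite_connected_subgraphs[OF assms(3)])
    show "inj_on ?m (connected_subgraphs G)"
    proof (rule inj_onI)
      fix K L assume KL: "K \<in> connected_subgraphs G" "L \<in> connected_subgraphs G" "?m K = ?m L"
      have "verts K = verts L"
        by (rule inj_onD[OF inj1]) (use KL connected_subgraphsD(1)[of _ G] in simp_all)
      moreover have "edges K = edges L"
        by (rule inj_onD[OF inj2])
          (use KL connected_subgraphsD(1)[OF KL(1)] connected_subgraphsD(3)[OF KL(1)]
            connected_subgraphsD(1)[OF KL(2)] connected_subgraphsD(3)[OF KL(2)]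
            in \<open>simp_all add: subset_iff\<close>)
      ultimately show "K = L" by (simp add: prod_eq_iff)
    qed
    show "?m ` connected_subgraphs G \<subseteq> connected_subgraphs H"
    proof (rule image_subsetI)
      fix K assume K: "K \<in> connected_subgraphs G"
      note D = connected_subgraphsD[OF K]
      show "?m K \<in> connected_subgraphs H"
      proof (rule connected_subgraphsI)
        show "verts (?m K) \<subseteq> verts H"
          using D(1) bij_betw_imp_surj_on[OF f] by auto
        show "edges (?m K) \<subseteq> edges H"
          unfolding E using D(2) by auto
        show "\<forall>e\<in>edges (?m K). e \<subseteq> verts (?m K)"
          using D(3) by auto
        show "connected_graph (?m K)"
          by (rule connected_graph_image[OF D(4)])
      qed
    qed
  qed
qed

lemma core_index_isomorphic:
  assumes "isomorphic G H" "simple_graph G" "simple_graph H"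
  shows "core_index G = core_index H"
  using core_index_le_of_isomorphic[OF assms]
    core_index_le_of_isomorphic[OF isomorphic_sym[OF assms] assms(3,2)]
  by (rule antisym)

section \<open>Paths and the extremal tree\<close>

lemma path_segment_connected:
  assumes "1 \<le> i" "i \<le> j" "j \<le> d"
  shows "connected_graph (induced (path_graph f d) (f ` {i..j}))"
  using assms(2,3)
proof (induction j rule: dec_induct)
  case base
  then show ?case using induced_singleton_connected by simp
next
  case (step j)
  have "{i..Suc j} = insert (Suc j) {i..j}" using step by auto
  then have "f ` {i..Suc j} = insert (f (Suc j)) (f ` {i..j})" by simp
  moreover have "{f j, f (Suc j)} \<in> edges (path_graph f d)"
    using step assms(1) by (auto simp: path_graph_def)
  ultimately show ?case
    using induced_connected_insert[OF step.IH, of "f j" "f (Suc j)"] step by simp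
qed

lemma path_end_in_cut_sets:
  assumes "inj_on f {1..d}" "2 \<le> d"
  shows "{f 1} \<in> cut_sets (path_graph f d)"
proof -
  have one: "{1..d} = insert 1 {2..d}" using assms(2) by auto
  have "f 1 \<notin> f ` {2..d}"
    using assms unfolding one by (simp add: inj_on_insert)
  then have "f ` {1..d} - {f 1} = f ` {2..d}"
    unfolding one by auto
  moreover have "f ` {2..d} \<noteq> {}" using assms(2) by simp
  ultimately show ?thesis
    using path_segment_connected[of 2 d d f] assms(2) induced_singleton_connected[of "path_graph f d" "f 1"]
    by (auto simp: cut_sets_def simp del: induced_simps)
qed

text \<open>Path edges join consecutive indices, so none jumps over \<open>i\<close> from the
  indices below it to those above.\<close>

lemma path_interior_not_in_cut_sets:
  assumes inj: "inj_on f {1..d}" and i: "1 < i" "i < d"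
  shows "{f i} \<notin> cut_sets (path_graph f d)"
proof
  let ?Y = "f ` {1..d} - {f i}"
  assume "{f i} \<in> cut_sets (path_graph f d)"
  then have con: "connected_graph (induced (path_graph f d) ?Y)"
    by (simp add: cut_sets_def)
  have neq: "f p \<noteq> f q" if "p \<in> {1..d}" "q \<in> {1..d}" "p \<noteq> q" for p q
    using inj that by (auto dest: inj_onD)
  have X: "f ` {1..<i} \<subseteq> ?Y"
    using neq[of _ i] i by auto
  have "f d \<in> ?Y" "f d \<notin> f ` {1..<i}"
    using neq[of d i] i by simp (use neq[of d] i in fastforce)
  then have neY: "f ` {1..<i} \<noteq> ?Y" by metis
  have ne: "f ` {1..<i} \<noteq> {}" using i by simp
  have sub: "\<forall>e\<in>edges (induced (path_graph f d) ?Y). e \<subseteq> verts (induced (path_graph f d) ?Y)"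
    by simp
  obtain u v where uv: "u \<in> f ` {1..<i}" "v \<in> ?Y" "v \<notin> f ` {1..<i}"
    "{u, v} \<in> edges (path_graph f d)"
    by (rule connected_graph_cutD[OF con sub, unfolded induced_simps, OF X ne neY]) blast
  then obtain p q m where pq: "p \<in> {1..<i}" "u = f p" "q \<in> {1..d}" "v = f q"
    and m: "1 \<le> m" "m < d" "{f p, f q} = {f m, f (Suc m)}"
    by (auto simp: path_graph_def)
  have "i < q" using pq uv by (metis DiffD2 atLeastAtMost_iff atLeastLessThan_iff image_eqI linorder_neqE_nat singletonI)
  have "f ` {p, q} = f ` {m, Suc m}" using m(3) by simp
  moreover have "{p, q} \<subseteq> {1..d}" "{m, Suc m} \<subseteq> {1..d}" using pq m i by auto
  ultimately have "{p, q} = {m, Suc m}"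
    using inj_on_image_eq_iff[OF inj] by blast
  then show False
    using pq(1) \<open>i < q\<close> by (auto simp: doubleton_eq_iff)
qed

text \<open>The minimum and maximum of the vertex set are the ends of the interval. For each
  \<open>m\<close> between them, only the edge \<open>{m, Suc m}\<close> can cross the cut after
  \<open>m\<close>. An inclusion suffices for the upper bound on the tree.\<close>

lemma connected_subgraphs_path:
  "connected_subgraphs (path_graph id d) \<subseteq>
    (\<lambda>(i, j). ({i..j}, {{m, Suc m} | m. i \<le> m \<and> m < j})) ` (SIGMA i:{1..d}. {i..d})"
proof
  fix H assume H: "H \<in> connected_subgraphs (path_graph id d)"
  note D = connected_subgraphsD[OF H]
  have A: "verts H \<subseteq> {1..d}" "finite (verts H)"
    using D(1) by (auto intro: finite_subset)
  define i j where "i = Min (verts H)" and "j = Max (verts H)"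
  have ij: "i \<in> verts H" "j \<in> verts H"
    unfolding i_def j_def using A(2) D(5) by simp_all
  have bnd: "i \<le> x" "x \<le> j" if "x \<in> verts H" for x
    using that A(2) by (auto simp: i_def j_def)
  have edge: "\<exists>m. e = {m, Suc m}" if "e \<in> edges H" for e
    using that D(2) by (auto simp: path_graph_def)
  have step: "{m, Suc m} \<in> edges H" if m: "i \<le> m" "m < j" for m
  proof -
    let ?X = "{x \<in> verts H. x \<le> m}"
    have "?X \<subseteq> verts H" "i \<in> ?X" "j \<notin> ?X" using ij m by auto
    then have "?X \<subseteq> verts H" "?X \<noteq> {}" "?X \<noteq> verts H" using ij by blast+
    then obtain u v where uv: "u \<in> ?X" "v \<in> verts H" "v \<notin> ?X" "{u, v} \<in> edges H"
      by (rule connected_graph_cutD[OF D(4,3)])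
    obtain m' where "{u, v} = {m', Suc m'}" using edge[OF uv(4)] by auto
    then have "u = m" "v = Suc m" using uv(1-3) by (auto simp: doubleton_eq_iff)
    then show ?thesis using uv by simp
  qed
  have mem: "x \<in> verts H" if "x \<in> {i..j}" for x
  proof (cases "x = j")
    case True
    then show ?thesis using ij(2) by simp
  next
    case False
    then have "{x, Suc x} \<in> edges H" using step[of x] that by simp
    then show ?thesis using D(3) by blast
  qed
  have V: "verts H = {i..j}"
  proof (intro equalityI subsetI)
    show "x \<in> {i..j}" if "x \<in> verts H" for x
      using bnd[OF that] by simp
  qed (rule mem)
  have "edges H = {{m, Suc m} | m. i \<le> m \<and> m < j}"
  proof (intro equalityI subsetI)
    fix e assume e: "e \<in> edges H"
    then obtain m where m: "e = {m, Suc m}" using edge by blast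
    then have "m \<in> verts H" "Suc m \<in> verts H" using D(3) e by auto
    then have "i \<le> m" "m < j" unfolding V by auto
    with m show "e \<in> {{m, Suc m} | m. i \<le> m \<and> m < j}" by auto
  qed (use step in auto)
  then have "H = (\<lambda>(i, j). ({i..j}, {{m, Suc m} | m. i \<le> m \<and> m < j})) (i, j)"
    using V by (simp add: prod_eq_iff)
  moreover have "(i, j) \<in> (SIGMA i:{1..d}. {i..d})"
    using ij A(1) bnd by auto
  ultimately show "H \<in> (\<lambda>(i, j). ({i..j}, {{m, Suc m} | m. i \<le> m \<and> m < j})) ` (SIGMA i:{1..d}. {i..d})"
    by (rule image_eqI)
qed

text \<open>The full interval weighs \<open>A * B\<close>. There are \<open>d - 1\<close> proper
  intervals starting at 1 and \<open>d - 1\<close> ending at \<open>d\<close>, of weights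
  \<open>A\<close> and \<open>B\<close>; the intervals avoiding both ends number
  \<open>(d - 1) * (d - 2) / 2\<close> and weigh 1 each.\<close>

lemma interval_weight_sum:
  fixes A B d :: nat
  assumes "1 \<le> d"
  shows "2 * (\<Sum>(i, j)\<in>(SIGMA i:{1..d}. {i..d}). (if i = 1 then A else 1) * (if j = d then B else 1))
    = 2 * (A * B) + 2 * (d - 1) * (A + B) + (d - 1) * (d - 2)"
proof -
  have inner: "(\<Sum>j = i..d. if j = d then B else 1) = d - i + B" if "i \<le> d" for i
  proof -
    have "{i..d} = insert d {i..<d}" using that by auto
    then show ?thesis by simp
  qed
  have rev: "(\<Sum>i = 2..d. d - i) = (\<Sum>i = 2..d. i - 2)"
    by (subst sum.atLeastAtMost_rev) simp
  have tri: "2 * (\<Sum>i = 2..e. i - 2) = (e - 1) * (e - 2)" for e :: nat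
  proof (induction e)
    case (Suc e)
    show ?case
    proof (cases "e \<le> 1")
      case False
      then obtain m where "e = Suc (Suc m)"
        by (metis One_nat_def Suc_n_not_le_n le0 le_Suc_eq not0_implies_Suc)
      then show ?thesis using Suc by simp
    qed (auto simp: le_Suc_eq)
  qed simp
  have "(\<Sum>(i, j)\<in>(SIGMA i:{1..d}. {i..d}). (if i = 1 then A else 1) * (if j = d then B else 1))
    = (\<Sum>i = 1..d. \<Sum>j = i..d. (if i = 1 then A else 1) * (if j = d then B else 1))"
    by (rule sum.Sigma[symmetric]) auto
  also have "\<dots> = (\<Sum>i = 1..d. (if i = 1 then A else 1) * (d - i + B))"
    by (rule sum.cong) (simp_all add: sum_distrib_left[symmetric] inner)
  also have "\<dots> = A * (d - 1 + B) + (\<Sum>i = 2..d. d - i + B)"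
  proof -
    have "{1..d} = insert 1 {2..d}" using assms by auto
    then show ?thesis by simp
  qed
  also have "(\<Sum>i = 2..d. d - i + B) = (\<Sum>i = 2..d. i - 2) + (d - 1) * B"
    unfolding sum.distrib rev by simp
  finally show ?thesis
    using tri[of d] by (simp add: distrib_left)
qed

section \<open>Upper bound for the core index of the extremal tree\<close>

lemma edges_T_tree:
  "edges (T_tree a b d) = (\<lambda>i. {i, Suc i}) ` {1..<d} \<union> (\<lambda>j. {1, j}) ` {d + 1..d + a}
    \<union> (\<lambda>j. {d, j}) ` {d + a + 1..d + a + b}"
  unfolding T_tree_def snd_conv Setcompr_eq_image by simp

lemma verts_T_tree: "verts (T_tree a b d) = {1..d + a + b}"
  by (simp add: T_tree_def)

lemma T_tree_pendant_attachment:
  assumes "1 \<le> d"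
  shows "pendant_attachment (T_tree a b d) {d + 1..d + a + b} (\<lambda>p. if p \<le> d + a then 1 else d)"
    (is "pendant_attachment ?T ?P ?nb")
proof
  show "simple_graph ?T" using assms by (intro simple_graph_T_tree) simp
  show "?P \<subseteq> verts ?T" by (auto simp: verts_T_tree)
  fix p assume p: "p \<in> ?P"
  show "?nb p \<in> verts ?T - ?P" using assms p by (auto simp: verts_T_tree)
  fix e
  show "e \<in> edges ?T \<and> p \<in> e \<longleftrightarrow> e = {p, ?nb p}"
  proof
    assume "e \<in> edges ?T \<and> p \<in> e"
    then show "e = {p, ?nb p}"
      using assms p unfolding edges_T_tree by auto
  next
    assume e: "e = {p, ?nb p}"
    show "e \<in> edges ?T \<and> p \<in> e"
    proof (cases "p \<le> d + a")
      case True
      then have "p \<in> {d + 1..d + a}" "e = {1, p}" using p e by auto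
      then show ?thesis unfolding edges_T_tree by blast
    next
      case False
      then have "p \<in> {d + a + 1..d + a + b}" "e = {d, p}" using p e by auto
      then show ?thesis unfolding edges_T_tree by blast
    qed
  qed
qed

text \<open>An upper bound is enough: for balanced \<open>a\<close> and \<open>b\<close> it
  coincides with the lower bound for arbitrary graphs, and the theorem follows by comparing the
  two.\<close>

lemma core_index_T_tree_le:
  assumes "2 \<le> d"
  shows "2 * core_index (T_tree a b d)
    \<le> 2 * (a + b) + (2 * 2 ^ (a + b) + 2 * (d - 1) * (2 ^ a + 2 ^ b) + (d - 1) * (d - 2))"
proof -
  define P where "P = {d + 1..d + a + b}"
  define nb where "nb p = (if p \<le> d + a then 1 else d)" for p
  interpret pendant_attachment "T_tree a b d" P nb
    unfolding P_def nb_def using assms by (intro T_tree_pendant_attachment) simp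
  let ?I = "SIGMA i:{1..d}. {i..d}"
  let ?h = "\<lambda>(i, j). ({i..j}, {{m, Suc m} | m. i \<le> m \<and> m < j}) :: nat ugraph"
  let ?w = "\<lambda>H :: nat ugraph. (2::nat) ^ card (hang (verts H))"
  have "verts (T_tree a b d) - P = {1..d}"
    by (auto simp: verts_T_tree P_def)
  moreover have "{e \<in> edges (T_tree a b d). e \<subseteq> {1..d}} = (\<lambda>i. {i, Suc i}) ` {1..<d}"
    unfolding edges_T_tree by auto
  moreover have "\<dots> = {{i, Suc i} | i. 1 \<le> i \<and> i < d}"
    by auto
  ultimately have core: "core = path_graph id d"
    unfolding core_def induced_def path_graph_def by simp
  have card_hang: "card (hang {i..j}) = (if i = 1 then a else 0) + (if j = d then b else 0)"
    if "(i, j) \<in> ?I" for i j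
  proof -
    have "hang {i..j} = (if i = 1 then {d + 1..d + a} else {}) \<union> (if j = d then {d + a + 1..d + a + b} else {})"
      unfolding hang_def unfolding P_def nb_def using that assms by auto
    then show ?thesis by (auto simp: card_Un_disjoint)
  qed
  have "(\<Sum>H\<in>connected_subgraphs core. ?w H) \<le> (\<Sum>H\<in>?h ` ?I. ?w H)"
    unfolding core by (intro sum_mono2 connected_subgraphs_path) auto
  also have "\<dots> \<le> (\<Sum>x\<in>?I. ?w (?h x))"
    using sum_image_le[of ?I ?w ?h] by (simp add: o_def)
  also have "\<dots> = (\<Sum>(i, j)\<in>?I. (if i = 1 then 2 ^ a else 1) * (if j = d then 2 ^ b else 1))"
    by (rule sum.cong) (auto simp: card_hang power_add)
  finally have "2 * (\<Sum>H\<in>connected_subgraphs core. ?w H)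
    \<le> 2 * (2 ^ a * 2 ^ b) + 2 * (d - 1) * (2 ^ a + 2 ^ b) + (d - 1) * (d - 2)"
    using interval_weight_sum[of d "2 ^ a" "2 ^ b"] assms by simp
  moreover have "card P = a + b" by (simp add: P_def)
  ultimately show ?thesis
    unfolding core_index_eq by (simp add: power_add)
qed

section \<open>Recognising the tree and the lower bound with its equality case\<close>

context pendant_attachment
begin

lemma edges_eq: "edges G = edges core \<union> (\<lambda>p. {p, nb p}) ` P"
proof (intro equalityI subsetI)
  fix e assume e: "e \<in> edges G"
  show "e \<in> edges core \<union> (\<lambda>p. {p, nb p}) ` P"
  proof (cases "e \<inter> P = {}")
    case True
    then show ?thesis using e simple by (auto simp: core_def simple_graph_def)
  next
    case False
    then obtain p where p: "p \<in> e" "p \<in> P" by blast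
    then have "e = {p, nb p}" using edge_iff e by blast
    then show ?thesis using p by blast
  qed
next
  fix e assume "e \<in> edges core \<union> (\<lambda>p. {p, nb p}) ` P"
  then show "e \<in> edges G"
  proof
    assume "e \<in> edges core"
    then show ?thesis by (simp add: core_def)
  next
    assume "e \<in> (\<lambda>p. {p, nb p}) ` P"
    then show ?thesis using edge_iff by blast
  qed
qed

lemma isomorphic_T_tree:
  assumes core: "core = path_graph f d" "inj_on f {1..d}" and d: "2 \<le> d"
    and a: "card (hang {f 1}) = a" and b: "card (hang {f d}) = b"
    and P: "P = hang {f 1} \<union> hang {f d}"
  shows "isomorphic G (T_tree a b d)"
proof -
  let ?A = "{d + 1..d + a}" and ?B = "{d + a + 1..d + a + b}"
  have fin: "finite (hang X)" for X using finite_P by (simp add: hang_def)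
  obtain h1 where h1: "bij_betw h1 ?A (hang {f 1})"
    using finite_same_card_bij[of ?A "hang {f 1}"] fin a by auto
  obtain h2 where h2: "bij_betw h2 ?B (hang {f d})"
    using finite_same_card_bij[of ?B "hang {f d}"] fin b by auto
  \<comment> \<open>The map goes from the tree to \<open>G\<close>: path vertices through
    \<open>f\<close>, each block of leaves through a bijection with the pendant vertices at the
    matching end. The three families of edges are then compared separately.\<close>
  define g where "g i = (if i \<le> d then f i else if i \<le> d + a then h1 i else h2 i)" for i
  have "f 1 \<noteq> f d" using inj_onD[OF core(2), of 1 d] d by auto
  have V: "f ` {1..d} = verts G - P"
    using arg_cong[OF core(1), of fst] by (simp add: core_def)
  have bij0: "bij_betw g {1..d} (verts G - P)"
    using bij_betw_imageI[OF core(2) V] by (rule bij_betw_cong[THEN iffD1, rotated]) (simp add: g_def)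
  have bij1: "bij_betw g ?A (hang {f 1})"
    using h1 by (rule bij_betw_cong[THEN iffD1, rotated]) (simp add: g_def)
  have bij2: "bij_betw g ?B (hang {f d})"
    using h2 by (rule bij_betw_cong[THEN iffD1, rotated]) (simp add: g_def)
  have "bij_betw g ({1..d} \<union> (?A \<union> ?B)) ((verts G - P) \<union> (hang {f 1} \<union> hang {f d}))"
  proof (intro bij_betw_combine bij0 bij1 bij2)
    show "hang {f 1} \<inter> hang {f d} = {}"
      using \<open>f 1 \<noteq> f d\<close> by (auto simp: hang_def)
    show "(verts G - P) \<inter> (hang {f 1} \<union> hang {f d}) = {}"
      by (auto simp: hang_def)
  qed
  moreover have "{1..d} \<union> (?A \<union> ?B) = verts (T_tree a b d)"
    by (auto simp: verts_T_tree)
  moreover have "(verts G - P) \<union> (hang {f 1} \<union> hang {f d}) = verts G"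
    using P P_sub by blast
  ultimately have bij: "bij_betw g (verts (T_tree a b d)) (verts G)"
    by simp
  have g: "g i = f i" if "i \<le> d" for i using that by (simp add: g_def)
  have "image g ` (\<lambda>i. {i, Suc i}) ` {1..<d} = (\<lambda>i. {f i, f (Suc i)}) ` {1..<d}"
    unfolding image_image by (rule image_cong) (auto simp: g)
  moreover have "\<dots> = edges (path_graph f d)"
    by (auto simp: path_graph_def)
  moreover have "image g ` (\<lambda>j. {1, j}) ` ?A = (\<lambda>p. {p, nb p}) ` hang {f 1}"
  proof -
    have "image g ` (\<lambda>j. {1, j}) ` ?A = (\<lambda>p. {f 1, p}) ` g ` ?A"
      unfolding image_image using d by (intro image_cong) (simp_all add: g)
    also have "\<dots> = (\<lambda>p. {f 1, p}) ` hang {f 1}"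
      using bij_betw_imp_surj_on[OF bij1] by simp
    also have "\<dots> = (\<lambda>p. {p, nb p}) ` hang {f 1}"
      by (rule image_cong) (auto simp: hang_def)
    finally show ?thesis .
  qed
  moreover have "image g ` (\<lambda>j. {d, j}) ` ?B = (\<lambda>p. {p, nb p}) ` hang {f d}"
  proof -
    have "image g ` (\<lambda>j. {d, j}) ` ?B = (\<lambda>p. {f d, p}) ` g ` ?B"
      unfolding image_image by (intro image_cong) (simp_all add: g)
    also have "\<dots> = (\<lambda>p. {f d, p}) ` hang {f d}"
      using bij_betw_imp_surj_on[OF bij2] by simp
    also have "\<dots> = (\<lambda>p. {p, nb p}) ` hang {f d}"
      by (rule image_cong) (auto simp: hang_def)
    finally show ?thesis .
  qed
  ultimately have E: "image g ` edges (T_tree a b d)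
      = edges (path_graph f d) \<union> (\<lambda>p. {p, nb p}) ` hang {f 1} \<union> (\<lambda>p. {p, nb p}) ` hang {f d}"
    unfolding edges_T_tree image_Un by simp
  have "(\<lambda>p. {p, nb p}) ` P = (\<lambda>p. {p, nb p}) ` hang {f 1} \<union> (\<lambda>p. {p, nb p}) ` hang {f d}"
    using arg_cong[OF P, of "image (\<lambda>p. {p, nb p})"] unfolding image_Un .
  then have "edges G = image g ` edges (T_tree a b d)"
    unfolding edges_eq core(1) E by (simp only: Un_assoc)
  moreover have T: "simple_graph (T_tree a b d)"
    using d by (intro simple_graph_T_tree) simp
  ultimately have "isomorphic (T_tree a b d) G"
    using bij by (intro isomorphic_of_edge_image) (auto simp: simple_graph_def)
  then show ?thesis
    using isomorphic_sym T simple by blast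
qed

text \<open>The weighted count is applied to the core with the number of hanging vertices as weight.
  In the equality case the core is a path, and testing the singletons of its vertices locates all
  pendant vertices at the two ends.\<close>

lemma core_index_lower_bound:
  assumes con: "connected_graph G" and k: "card P = k" "2 \<le> k"
    and d: "card (verts G - P) = d" "2 \<le> d"
  defines "M \<equiv> 2 * 2 ^ k + 2 * (d - 1) * (2 ^ (k div 2) + 2 ^ ((k + 1) div 2)) + (d - 1) * (d - 2)"
  shows "2 * k + M \<le> 2 * core_index G"
    and "2 * core_index G = 2 * k + M \<Longrightarrow> isomorphic G (T_tree (k div 2) ((k + 1) div 2) d)"
proof -
  let ?W = "\<lambda>X. card (hang X)"
  have Vc: "verts core = verts G - P" by (simp add: core_def)
  have "verts G \<noteq> P" using d by auto
  note conc = connected_core[OF con this]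
  have "hang (verts core) = P" using nb by (auto simp: hang_def Vc)
  then have Wk: "?W (verts core) = k" using k by simp
  have Wc: "\<forall>X\<subseteq>verts core. ?W X + ?W (verts core - X) = k"
    using card_hang_complement k by simp
  have dc: "card (verts core) = d" using d Vc by simp
  note wsum = weighted_subgraph_sum[OF simple_core conc dc d(2) Wk Wc k(2), folded M_def]
  show "2 * k + M \<le> 2 * core_index G"
    using wsum(1) k(1) unfolding core_index_eq by simp
  assume "2 * core_index G = 2 * k + M"
  then have "2 * (\<Sum>H\<in>connected_subgraphs core. 2 ^ ?W (verts H)) = M"
    using k(1) unfolding core_index_eq by simp
  from wsum(2)[OF this]
  obtain f where f: "inj_on f {1..d}" "core = path_graph f d"
    and bal: "\<And>X. X \<in> cut_sets core \<Longrightarrow> ?W X = k div 2 \<or> ?W X = (k + 1) div 2"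
    and zero: "\<And>X. X \<subseteq> verts core \<Longrightarrow> connected_graph (induced core X) \<Longrightarrow> X \<notin> cut_sets core \<Longrightarrow>
      X \<noteq> verts core \<Longrightarrow> ?W X = 0"
    by blast
  have V: "f ` {1..d} = verts core"
    using arg_cong[OF f(2), of fst] by simp
  \<comment> \<open>An interior singleton is connected but its complement is not, so it belongs to
    the sets of weight zero.\<close>
  have mid: "hang {f i} = {}" if i: "1 < i" "i < d" for i
  proof -
    have "f i \<in> f ` {1..d}" using i by simp
    then have sub: "{f i} \<subseteq> verts core" unfolding V by simp
    have ne: "{f i} \<noteq> verts core"
      using dc d(2) by (metis card_1_singleton_iff Suc_1 not_less_eq_eq One_nat_def le_refl)
    have "{f i} \<notin> cut_sets core"
      unfolding f(2) by (rule path_interior_not_in_cut_sets[OF f(1) i])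
    then have "?W {f i} = 0"
      using zero[OF sub induced_singleton_connected _ ne] by simp
    then show ?thesis using finite_P by (simp add: hang_def)
  qed
  have P: "P = hang {f 1} \<union> hang {f d}"
  proof (intro equalityI subsetI)
    fix p assume p: "p \<in> P"
    then have "nb p \<in> f ` {1..d}" unfolding V Vc by (rule nb)
    then obtain i where i: "i \<in> {1..d}" "nb p = f i" by blast
    then have "p \<in> hang {f i}" using p by (simp add: hang_def)
    moreover from this have "\<not> (1 < i \<and> i < d)" using mid by blast
    then have "i = 1 \<or> i = d" using i(1) by auto
    ultimately show "p \<in> hang {f 1} \<union> hang {f d}" by auto
  qed (auto simp: hang_def)
  have "f 1 \<noteq> f d" using inj_onD[OF f(1), of 1 d] d by auto
  then have "hang {f 1} \<inter> hang {f d} = {}" by (auto simp: hang_def)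
  then have sum: "?W {f 1} + ?W {f d} = k"
    using P k(1) finite_P by (metis card_Un_disjoint finite_Un)
  \<comment> \<open>The singleton of an end is a cut set, so the balance condition applies to
    it.\<close>
  have "?W {f 1} = k div 2 \<or> ?W {f 1} = (k + 1) div 2"
    using bal path_end_in_cut_sets[OF f(1) d(2)] f(2) by simp
  then show "isomorphic G (T_tree (k div 2) ((k + 1) div 2) d)"
  proof
    assume "?W {f 1} = k div 2"
    then show ?thesis
      using sum by (intro isomorphic_T_tree[OF f(2,1) d(2) _ _ P]) auto
  next
    assume w: "?W {f 1} = (k + 1) div 2"
    \<comment> \<open>The path is reversed so that its first vertex carries \<open>k div 2\<close>
      pendant vertices, as in the target tree.\<close>
    let ?f = "\<lambda>i. f (Suc d - i)"
    have inj: "inj_on ?f {1..d}"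
      by (rule inj_on_reverse[OF f(1)])
    have "core = path_graph ?f d"
      unfolding path_graph_reverse[of f d] by (rule f(2))
    then show ?thesis
      by (rule isomorphic_T_tree[OF _ inj d(2)]) (use w sum P in \<open>simp_all add: Un_commute\<close>)
  qed
qed

end

text \<open>The point to check is that neighbours of pendant vertices are not pendant: two adjacent
  pendant vertices have no edge leaving them, which is impossible in a connected graph with at least
  three vertices.\<close>

lemma pendant_attachment_pendant_verts:
  assumes G: "simple_graph G" "connected_graph G" and n: "3 \<le> card (verts G)"
  shows "\<exists>nb. pendant_attachment G (pendant_verts G) nb"
proof -
  have ex: "\<exists>u. u \<in> verts G \<and> u \<noteq> p \<and> {e \<in> edges G. p \<in> e} = {{p, u}}" if p: "p \<in> pendant_verts G" for p
  proof -
    obtain e where e: "{e \<in> edges G. p \<in> e} = {e}"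
      using p unfolding pendant_verts_def degree_def by (auto simp: card_1_singleton_iff)
    then have "e \<in> edges G" "p \<in> e" by blast+
    then obtain u where u: "e = {u, p}" "u \<noteq> p" "u \<in> verts G"
      by (rule simple_graph_edgeE[OF G(1)])
    then show ?thesis using e by (metis insert_commute)
  qed
  then obtain nb where nb: "\<And>p. p \<in> pendant_verts G \<Longrightarrow>
      nb p \<in> verts G \<and> nb p \<noteq> p \<and> {e \<in> edges G. p \<in> e} = {{p, nb p}}"
    by metis
  have edge: "e \<in> edges G \<and> p \<in> e \<longleftrightarrow> e = {p, nb p}" if "p \<in> pendant_verts G" for p e
    using nb[OF that] by blast
  have "nb p \<notin> pendant_verts G" if p: "p \<in> pendant_verts G" for p
  proof
    assume q: "nb p \<in> pendant_verts G"
    let ?X = "{p, nb p}"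
    have X: "?X \<subseteq> verts G" "?X \<noteq> {}"
      using p nb[OF p] by (auto simp: pendant_verts_def)
    have "card ?X \<le> 2" by (simp add: card_insert_if)
    then have ne: "?X \<noteq> verts G" using n by auto
    have "\<forall>e\<in>edges G. e \<subseteq> verts G" using G(1) by (simp add: simple_graph_def)
    then obtain u v where uv: "u \<in> ?X" "v \<notin> ?X" "{u, v} \<in> edges G"
      using connected_graph_cutD[OF G(2) _ X ne] by metis
    have only: "?X = {nb p, nb (nb p)}"
      using edge[OF p, of ?X] edge[OF q, of ?X] by blast
    from uv(1) have "{u, v} = ?X"
      using edge[OF p, of "{u, v}"] edge[OF q, of "{u, v}"] uv(3) only by blast
    then show False using uv(2) by blast
  qed
  then have "pendant_attachment G (pendant_verts G) nb"
    using G nb edge by unfold_locales (auto simp: pendant_verts_def)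
  then show ?thesis by blast
qed

theorem theorem5p5:
  fixes G :: "'a ugraph" and n k :: nat
  assumes "n \<ge> 4" and "2 \<le> k" and "k \<le> n - 2"
    and "simple_graph G" and "connected_graph G"
    and "card (verts G) = n" and "card (pendant_verts G) = k"
  shows "core_index G \<ge> core_index (T_tree (k div 2) ((k + 1) div 2) (n - k)) \<and>
         (core_index G = core_index (T_tree (k div 2) ((k + 1) div 2) (n - k)) \<longleftrightarrow>
            isomorphic G (T_tree (k div 2) ((k + 1) div 2) (n - k)))"
proof -
  let ?T = "T_tree (k div 2) ((k + 1) div 2) (n - k)"
  obtain nb where "pendant_attachment G (pendant_verts G) nb"
    using pendant_attachment_pendant_verts[OF assms(4,5)] assms(1,6) by auto
  then interpret pendant_attachment G "pendant_verts G" nb .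
  have d: "2 \<le> n - k" using assms(1,3) by simp
  have "card (verts G - pendant_verts G) = n - k"
    using card_Diff_subset[OF finite_P P_sub] assms(6,7) by simp
  note low = core_index_lower_bound[OF assms(5,7,2) this d]
  have sum: "k div 2 + (k + 1) div 2 = k" by simp
  note up = core_index_T_tree_le[OF d, of "k div 2" "(k + 1) div 2", unfolded sum]
  have "simple_graph ?T" using d by (intro simple_graph_T_tree) simp
  then have "isomorphic G ?T \<Longrightarrow> core_index G = core_index ?T"
    using core_index_isomorphic assms(4) by blast
  moreover have "core_index ?T \<le> core_index G"
    using low(1) up by linarith
  \<comment> \<open>Equality with the tree puts \<open>core_index G\<close> under the upper bound
    for the tree. The lower bound is then attained, and its equality case applies.\<close>
  moreover have "isomorphic G ?T" if "core_index G = core_index ?T"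
    by (rule low(2)) (use low(1) up that in linarith)
  ultimately show ?thesis by blast
qed

end
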